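(* Let $\mathcal O^2$ be a turnover with $\chi(\mathcal O^2)<0$, and let $\rho\colon\pi_1(\mathcal O^2)\to\mathrm{SL}_3(\mathbb R)\subset\mathrm{SL}_4(\mathbb R)$ be the projective holonomy of a convex projective structure on $\mathcal O^2$. Then every deformation of $\rho$ in $\mathrm{SL}_4(\mathbb R)$ is conjugate to a deformation of $\rho$ in $\mathrm{SL}_3(\mathbb R)$; that is, for every neighborhood $W$ of $\rho$ in $\hom(\pi_1(\mathcal O^2),\mathrm{SL}_3(\mathbb R))$ there is a neighborhood of $\rho$ in $\hom(\pi_1(\mathcal O^2),\mathrm{SL}_4(\mathbb R))$ each of whose elements is conjugate in $\mathrm{SL}_4(\mathbb R)$ to an element of $W$.
   Context: A turnover is the closed orientable 2-orbifold whose underlying space is a 2-sphere and which has three cone points. The inclusion $\mathrm{SL}_3(\mathbb R)\subset\mathrm{SL}_4(\mathbb R)$ is $A\mapsto\begin{pmatrix}A&0\\0&1\end{pmatrix}$. The projective holonomy of a convex projective structure on an orientable 2-orbifold with negative Euler characteristic lifts to $\mathrm{SL}_3(\mathbb R)$. "Deformation" of $\rho$ means a representation close to $\rho$ in the variety of representations. *)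

theory Defs
  imports "HOL-Analysis.Analysis" "HOL-Algebra.Group"
begin

section \<open>Groups given by generators and relators\<close>

text \<open>The letter \<open>(s, True)\<close> stands for the generator \<open>s\<close>, the letter \<open>(s, False)\<close> for its inverse.\<close>

type_synonym 's word = "('s \<times> bool) list"

inductive word_eq :: "'s word set \<Rightarrow> 's word \<Rightarrow> 's word \<Rightarrow> bool" for R where
  refl: "word_eq R u u"
| sym: "word_eq R u v \<Longrightarrow> word_eq R v u"
| trans: "word_eq R u v \<Longrightarrow> word_eq R v w \<Longrightarrow> word_eq R u w"
| append: "word_eq R u u' \<Longrightarrow> word_eq R v v' \<Longrightarrow> word_eq R (u @ v) (u' @ v')"
| cancel: "word_eq R [(s, b), (s, \<not> b)] []"
| relator: "r \<in> R \<Longrightarrow> word_eq R r []"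

definition word_class :: "'s word set \<Rightarrow> 's word \<Rightarrow> 's word set" where
  "word_class R u = {v. word_eq R u v}"

definition presented_group :: "'s word set \<Rightarrow> 's word set monoid" where
  "presented_group R =
     \<lparr>carrier = range (word_class R),
      mult = (\<lambda>X Y. {w. \<exists>u\<in>X. \<exists>v\<in>Y. word_eq R (u @ v) w}),
      one = word_class R []\<rparr>"

lemma word_class_eq_iff: "word_class R u = word_class R v \<longleftrightarrow> word_eq R u v"
  unfolding word_class_def by (blast intro: word_eq.refl word_eq.sym word_eq.trans)

lemma presented_group_mult [simp]:
  "word_class R u \<otimes>\<^bsub>presented_group R\<^esub> word_class R v = word_class R (u @ v)"
  unfolding presented_group_def word_class_def
  by (auto intro: word_eq.refl word_eq.trans word_eq.append)

lemma word_eq_inverse: "word_eq R (map (\<lambda>(s, b). (s, \<not> b)) (rev u) @ u) []"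
proof (induction u)
  case Nil
  show ?case by (simp add: word_eq.refl)
next
  case (Cons x u)
  obtain s b where x: "x = (s, b)" by force
  let ?i = "map (\<lambda>(s, b). (s, \<not> b)) (rev u)"
  have "word_eq R [(s, \<not> b), (s, \<not> \<not> b)] []" by (rule word_eq.cancel)
  then have "word_eq R ([(s, \<not> b), (s, b)] @ u) ([] @ u)"
    by (intro word_eq.append word_eq.refl) simp
  then have "word_eq R (?i @ ([(s, \<not> b), (s, b)] @ u)) (?i @ u)"
    by (intro word_eq.append word_eq.refl) simp
  with Cons.IH show ?case by (auto simp: x intro: word_eq.trans)
qed

lemma group_presented_group: "group (presented_group R)"
proof (rule groupI)
  fix X assume "X \<in> carrier (presented_group R)"
  then obtain u where "X = word_class R u" by (auto simp: presented_group_def)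
  moreover have "word_class R (map (\<lambda>(s, b). (s, \<not> b)) (rev u)) \<in> carrier (presented_group R)"
    by (simp add: presented_group_def)
  moreover have "\<one>\<^bsub>presented_group R\<^esub> = word_class R []" by (simp add: presented_group_def)
  ultimately show "\<exists>Y\<in>carrier (presented_group R). Y \<otimes>\<^bsub>presented_group R\<^esub> X = \<one>\<^bsub>presented_group R\<^esub>"
    using word_eq_inverse presented_group_mult word_class_eq_iff by metis
next
  fix X Y assume "X \<in> carrier (presented_group R)" "Y \<in> carrier (presented_group R)"
  then obtain u v where "X = word_class R u" "Y = word_class R v"
    by (auto simp: presented_group_def)
  then show "X \<otimes>\<^bsub>presented_group R\<^esub> Y \<in> carrier (presented_group R)"
    using presented_group_mult[of R u v] by (simp add: presented_group_def)
next
  fix X Y Z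
  assume "X \<in> carrier (presented_group R)" "Y \<in> carrier (presented_group R)"
    "Z \<in> carrier (presented_group R)"
  then obtain u v w where "X = word_class R u" "Y = word_class R v" "Z = word_class R w"
    by (auto simp: presented_group_def)
  then show "X \<otimes>\<^bsub>presented_group R\<^esub> Y \<otimes>\<^bsub>presented_group R\<^esub> Z =
      X \<otimes>\<^bsub>presented_group R\<^esub> (Y \<otimes>\<^bsub>presented_group R\<^esub> Z)" by simp
next
  show "\<one>\<^bsub>presented_group R\<^esub> \<in> carrier (presented_group R)" by (simp add: presented_group_def)
next
  fix X assume "X \<in> carrier (presented_group R)"
  then obtain u where "X = word_class R u" by (auto simp: presented_group_def)
  moreover have "\<one>\<^bsub>presented_group R\<^esub> = word_class R []" by (simp add: presented_group_def)
  ultimately show "\<one>\<^bsub>presented_group R\<^esub> \<otimes>\<^bsub>presented_group R\<^esub> X = X" by simp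
qed


section \<open>Turnovers\<close>

datatype cone = C1 | C2 | C3

record turnover =
  cone_point :: "cone \<Rightarrow> real^3"
  cone_order :: "cone \<Rightarrow> nat"

definition turnover :: "turnover \<Rightarrow> bool" where
  "turnover T \<longleftrightarrow>
     inj (cone_point T) \<and> range (cone_point T) \<subseteq> sphere 0 1 \<and> (\<forall>i. cone_order T i \<ge> 2)"

definition regular_part :: "turnover \<Rightarrow> (real^3) set" where
  "regular_part T = sphere 0 1 - range (cone_point T)"

definition local_order :: "turnover \<Rightarrow> real^3 \<Rightarrow> nat" where
  "local_order T x = (if \<exists>i. x = cone_point T i then cone_order T (THE i. x = cone_point T i) else 1)"

definition orbifold_euler_char :: "turnover \<Rightarrow> real" where
  "orbifold_euler_char T = 2 - (\<Sum>i\<in>{C1, C2, C3}. 1 - 1 / real (cone_order T i))"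

text \<open>
  The orbifold fundamental group is the fundamental group of the regular part with the powers
  of the loops around the cone points killed:
  \<open>\<langle>a\<^sub>1, a\<^sub>2, a\<^sub>3 | a\<^sub>1 a\<^sub>2 a\<^sub>3, a\<^sub>i ^ n\<^sub>i\<rangle>\<close>.
  The generators are the classes of a system of loops as in \<open>standard_loops\<close> below.
\<close>

definition turnover_relators :: "turnover \<Rightarrow> cone word set" where
  "turnover_relators T =
     insert [(C1, True), (C2, True), (C3, True)]
       (range (\<lambda>i. replicate (cone_order T i) (i, True)))"

abbreviation orbifold_pi1 :: "turnover \<Rightarrow> cone word set monoid" where
  "orbifold_pi1 T \<equiv> presented_group (turnover_relators T)"

definition pi1_gen :: "turnover \<Rightarrow> cone \<Rightarrow> cone word set" where
  "pi1_gen T i = word_class (turnover_relators T) [(i, True)]"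

text \<open>
  Three simple loops with a common base point, otherwise disjoint, where the \<open>i\<close>-th loop
  separates the \<open>i\<close>-th cone point from the other two. The homotopy forces the three loops to turn
  around their cone points in the same direction and to be numbered in the cyclic order in
  which they leave the base point, so that their classes satisfy exactly the relations above.
\<close>

definition standard_loops :: "turnover \<Rightarrow> (cone \<Rightarrow> real \<Rightarrow> real^3) \<Rightarrow> bool" where
  "standard_loops T \<gamma> \<longleftrightarrow>
     (\<exists>b. (\<forall>i. simple_path (\<gamma> i) \<and> pathstart (\<gamma> i) = b \<and> pathfinish (\<gamma> i) = b \<and>
               path_image (\<gamma> i) \<subseteq> regular_part T) \<and>
          (\<forall>i j. i \<noteq> j \<longrightarrow> path_image (\<gamma> i) \<inter> path_image (\<gamma> j) = {b}) \<and>
          (\<forall>i j. i \<noteq> j \<longrightarrow>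
             \<not> connected_component (sphere 0 1 - path_image (\<gamma> i)) (cone_point T i) (cone_point T j)) \<and>
          (\<forall>i j k. j \<noteq> i \<longrightarrow> k \<noteq> i \<longrightarrow>
             connected_component (sphere 0 1 - path_image (\<gamma> i)) (cone_point T j) (cone_point T k)) \<and>
          homotopic_paths (regular_part T) (\<gamma> C1 +++ \<gamma> C2 +++ \<gamma> C3) (linepath b b))"


section \<open>Convex projective structures\<close>

text \<open>Points of the projective space are the lines through the origin.\<close>

definition projective_space :: "(real^'n) set topology" where
  "projective_space =
     topology (\<lambda>U. U \<subseteq> (\<lambda>v. span {v}) ` (- {0}) \<and> open {v. v \<noteq> 0 \<and> span {v} \<in> U})"

lemma openin_projective_space:
  "openin projective_space U \<longleftrightarrow>
     U \<subseteq> (\<lambda>v. span {v}) ` (- {0}) \<and> open {v :: real^'n. v \<noteq> 0 \<and> span {v} \<in> U}"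
proof -
  have "istopology (\<lambda>U. U \<subseteq> (\<lambda>v. span {v}) ` (- {0}) \<and>
      open {v :: real^'n. v \<noteq> 0 \<and> span {v} \<in> U})" (is "istopology ?P")
    unfolding istopology_def
  proof (intro conjI allI impI)
    fix S T :: "(real^'n) set set" assume "?P S" "?P T"
    moreover have "{v. v \<noteq> 0 \<and> span {v} \<in> S \<inter> T} =
        {v. v \<noteq> 0 \<and> span {v} \<in> S} \<inter> {v. v \<noteq> 0 \<and> span {v} \<in> T}" by blast
    ultimately show "S \<inter> T \<subseteq> (\<lambda>v. span {v}) ` (- {0})"
      and "open {v. v \<noteq> 0 \<and> span {v} \<in> S \<inter> T}" by auto
  next
    fix \<K> :: "(real^'n) set set set" assume K: "\<forall>U\<in>\<K>. ?P U"
    then show "\<Union> \<K> \<subseteq> (\<lambda>v. span {v}) ` (- {0})" by blast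
    have "{v. v \<noteq> 0 \<and> span {v} \<in> \<Union> \<K>} = (\<Union>U\<in>\<K>. {v. v \<noteq> 0 \<and> span {v} \<in> U})" by blast
    with K show "open {v. v \<noteq> 0 \<and> span {v} \<in> \<Union> \<K>}" by auto
  qed
  then show ?thesis by (simp add: projective_space_def)
qed

text \<open>
  A domain is convex if it misses some projective line and is convex in the affine chart
  given by the complement of that line.
\<close>

definition convex_domain :: "(real^3) set set \<Rightarrow> bool" where
  "convex_domain \<Omega> \<longleftrightarrow>
     openin projective_space \<Omega> \<and> \<Omega> \<noteq> {} \<and>
     (\<exists>w. (\<forall>l\<in>\<Omega>. \<not> l \<subseteq> {x. w \<bullet> x = 0}) \<and> convex {x. w \<bullet> x = 1 \<and> span {x} \<in> \<Omega>})"

definition SL :: "(real^'n^'n) monoid" where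
  "SL = \<lparr>carrier = {A. det A = 1}, mult = (**), one = mat 1\<rparr>"

definition proj_act :: "real^'n^'n \<Rightarrow> (real^'n) set \<Rightarrow> (real^'n) set" where
  "proj_act A l = (\<lambda>x. A *v x) ` l"

text \<open>
  A convex projective structure on \<open>T\<close> identifies \<open>T\<close> with \<open>\<Omega>/\<Gamma>\<close>, where \<open>\<Gamma>\<close> acts properly
  discontinuously on the convex domain \<open>\<Omega>\<close>; the identification is given by the projection
  \<open>q\<close> from \<open>\<Omega>\<close> to the underlying sphere. Since \<open>PGL\<^sub>3(\<real>) = SL\<^sub>3(\<real>)\<close>, the group \<open>\<Gamma>\<close> is taken in
  \<open>SL\<^sub>3(\<real>)\<close>. The isotropy groups are required to have the order prescribed by \<open>T\<close>; they are then
  cyclic rotation groups, as reflections would produce boundary in the quotient.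
\<close>

definition convex_projective_structure ::
  "turnover \<Rightarrow> (real^3) set set \<Rightarrow> (real^3^3) set \<Rightarrow> ((real^3) set \<Rightarrow> real^3) \<Rightarrow> bool" where
  "convex_projective_structure T \<Omega> \<Gamma> q \<longleftrightarrow>
     convex_domain \<Omega> \<and> subgroup \<Gamma> SL \<and>
     (\<forall>A\<in>\<Gamma>. proj_act A ` \<Omega> = \<Omega>) \<and>
     (\<forall>K. K \<subseteq> \<Omega> \<longrightarrow> compactin projective_space K \<longrightarrow>
        finite {A\<in>\<Gamma>. proj_act A ` K \<inter> K \<noteq> {}}) \<and>
     quotient_map (subtopology projective_space \<Omega>) (top_of_set (sphere 0 1)) q \<and>
     (\<forall>l\<in>\<Omega>. \<forall>m\<in>\<Omega>. q l = q m \<longleftrightarrow> (\<exists>A\<in>\<Gamma>. m = proj_act A l)) \<and>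
     (\<forall>l\<in>\<Omega>. card {A\<in>\<Gamma>. proj_act A l = l} = local_order T (q l))"

text \<open>
  As \<open>\<Omega>\<close> is the universal cover of \<open>\<Omega>/\<Gamma>\<close>, the holonomy is the isomorphism from the fundamental
  group to the deck group \<open>\<Gamma>\<close>: the lift of the \<open>i\<close>-th loop from the base point \<open>l\<^sub>0\<close> ends at the
  image of \<open>l\<^sub>0\<close> under the holonomy of the \<open>i\<close>-th generator. Changing \<open>l\<^sub>0\<close> in its fibre conjugates
  the holonomy.
\<close>

definition convex_projective_holonomy ::
  "turnover \<Rightarrow> (cone \<Rightarrow> real \<Rightarrow> real^3) \<Rightarrow> (cone word set \<Rightarrow> real^3^3) \<Rightarrow> bool" where
  "convex_projective_holonomy T \<gamma> \<rho> \<longleftrightarrow>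
     (\<exists>\<Omega> \<Gamma> q. convex_projective_structure T \<Omega> \<Gamma> q \<and>
        \<rho> \<in> iso (orbifold_pi1 T) (SL\<lparr>carrier := \<Gamma>\<rparr>) \<and>
        (\<exists>l\<^sub>0\<in>\<Omega>. \<forall>i. \<exists>c. pathin (subtopology projective_space \<Omega>) c \<and>
           (\<forall>t\<in>{0..1}. q (c t) = \<gamma> i t) \<and>
           c 0 = l\<^sub>0 \<and> c 1 = proj_act (\<rho> (pi1_gen T i)) l\<^sub>0))"


section \<open>Spaces of representations\<close>

text \<open>
  Homomorphisms are made extensional, so that two of them are equal if they agree on the group.
  The topology of pointwise convergence is the one inherited from the embedding of the
  representation variety that evaluates a representation at the three generators.
\<close>

definition rep_space :: "'g monoid \<Rightarrow> ('g \<Rightarrow> real^'n^'n) topology" where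
  "rep_space G = subtopology (product_topology (\<lambda>_. euclidean) (carrier G)) (hom G SL)"

definition SL3_to_SL4 :: "real^3^3 \<Rightarrow> real^4^4" where
  "SL3_to_SL4 A = vector
     [vector [A$1$1, A$1$2, A$1$3, 0],
      vector [A$2$1, A$2$2, A$2$3, 0],
      vector [A$3$1, A$3$2, A$3$3, 0],
      vector [0, 0, 0, 1]]"

definition extend_rep :: "'g monoid \<Rightarrow> ('g \<Rightarrow> real^3^3) \<Rightarrow> 'g \<Rightarrow> real^4^4" where
  "extend_rep G \<rho> = restrict (SL3_to_SL4 \<circ> \<rho>) (carrier G)"

definition conjugate_reps :: "'g monoid \<Rightarrow> ('g \<Rightarrow> real^'n^'n) \<Rightarrow> ('g \<Rightarrow> real^'n^'n) \<Rightarrow> bool" where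
  "conjugate_reps G \<sigma> \<tau> \<longleftrightarrow>
     (\<exists>P. det P = 1 \<and> (\<forall>g\<in>carrier G. \<sigma> g = P ** \<tau> g ** matrix_inv P))"

end

(*
The Euler characteristic of a representation V of the turnover group is -dim V plus the dimensions
of the fixed spaces of the three generators. Near rho + 1 these fixed spaces in R^4 have dimension
at least 2, so by duality (here an elementary count of dimensions) the dimensions of the spaces of
common fixed vectors and of common fixed covectors add up to at least 2. If rho fixes no nonzero
vector and no nonzero covector of R^3, both are at most 1 by semicontinuity, so every nearby
representation fixes a vector v and a covector phi, both close to the last basis vector, and R^4
splits as ker phi + R v.

That the holonomy rho fixes nothing in R^3 rests on two facts about the commutator h of the first
two generators, both read off from the hyperbolic triangle group in SL_2(C): h has infinite order,
and it does not commute with one of its conjugates by a generator. By properness h fixes no point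
of the domain. A fixed vector outside the domain, or a fixed covector vanishing somewhere on it,
forces the generators to act as +1 or -1 on the plane of the other directions. If a fixed covector
does not vanish on the domain, the group acts by area-preserving affine maps, and either their
linear parts commute or h is hyperbolic with a fixed point inside the domain.
*)

theory Submission
  imports Defs
begin

section \<open>Powers and traces of matrices\<close>

text \<open>A convex domain may be a whole affine chart, so the group could a priori act by affine
  maps and convexity alone excludes neither a fixed vector nor a fixed covector. Faithfulness and
  properness do: the holonomy is injective, so words that differ in the abstract group give
  different matrices. Such words are told apart by one explicit pair of matrices in SL_2(C). There
  the relators hold only up to sign, so the tests used, a real trace above 2 and commuting up to
  sign, tolerate a sign. Complex entries allow the traces to be prescribed directly. The commutator
  is the right element because it becomes trivial wherever the generators commute, in particular
  where they act as scalars. The dimension 2 of the fixed spaces in R^4 is a fixed line of an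
  element of finite order in odd dimension 3 together with the last axis. A fixed space may shrink
  under a perturbation; here the relations persist, the generators keep their finite orders, and
  averaging over powers prevents the drop.\<close>

primrec mpow :: "'a::comm_ring_1^'n^'n \<Rightarrow> nat \<Rightarrow> 'a^'n^'n" where
  "mpow A 0 = mat 1"
| "mpow A (Suc k) = A ** mpow A k"

lemma mpow_add: "mpow A (m + n) = mpow A m ** mpow A n"
  by (induction m) (simp_all add: matrix_mul_assoc)

lemma mpow_mult: "mpow A (m * n) = mpow (mpow A m) n"
  by (induction n) (simp_all add: mpow_add)

lemma mpow_mat_1 [simp]: "mpow (mat 1) n = mat 1"
  by (induction n) simp_all

text \<open>Chebyshev polynomials normalised so that \<open>cheb (x + 1/x) k\<close> is x^k +
  x^(-k). They give the trace of the k-th power of a 2x2 matrix of determinant 1 and trace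
  \<open>t\<close>.\<close>

fun cheb :: "'a::comm_ring_1 \<Rightarrow> nat \<Rightarrow> 'a" where
  "cheb t 0 = 2"
| "cheb t (Suc 0) = t"
| "cheb t (Suc (Suc k)) = t * cheb t (Suc k) - cheb t k"

lemma cheb_of_real: "cheb (of_real t :: 'a::{real_algebra_1,comm_ring_1}) k = of_real (cheb t k)"
  by (induction t k rule: cheb.induct) simp_all

lemma abs_cheb_less:
  fixes t :: real
  assumes "\<bar>t\<bar> > 2"
  shows "\<bar>cheb t k\<bar> < \<bar>cheb t (Suc k)\<bar>"
proof (induction k)
  case (Suc k)
  have "2 * \<bar>cheb t (Suc k)\<bar> \<le> \<bar>t\<bar> * \<bar>cheb t (Suc k)\<bar>"
    using assms by (intro mult_right_mono) auto
  with Suc show ?case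
    by (simp add: abs_mult[symmetric])
qed (use assms in auto)

text \<open>Source of infinite order modulo sign: once a trace exceeds 2 in absolute value, no
  positive power returns to trace 2 or -2.\<close>

lemma abs_cheb_gt_2:
  fixes t :: real
  assumes "\<bar>t\<bar> > 2" "k > 0"
  shows "\<bar>cheb t k\<bar> > 2"
proof -
  have "2 < \<bar>cheb t (Suc k)\<bar>" for k
  proof (induction k)
    case (Suc k)
    then show ?case using abs_cheb_less[OF assms(1), of "Suc k"] by linarith
  qed (use assms in auto)
  from this[of "k - 1"] show ?thesis using assms(2) by simp
qed

text \<open>The adjugate: for determinant 1 it is the inverse, but it is polynomial in the entries,
  so trace identities can be checked by expansion over any commutative ring.\<close>

definition adj2 :: "'a::comm_ring_1^2^2 \<Rightarrow> 'a^2^2" where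
  "adj2 A = vector [vector [A$2$2, - A$1$2], vector [- A$2$1, A$1$1]]"

lemmas mat2_simps = vec_eq_iff forall_2 sum_2 matrix_matrix_mult_def trace_def det_2 adj2_def mat_def

lemma adj2_mult:
  assumes "det A = 1"
  shows "A ** adj2 A = mat 1" "adj2 A ** A = mat 1"
  using assms by (simp_all add: mat2_simps algebra_simps)

lemma adj2_mult_distrib: "adj2 (A ** B) = adj2 B ** adj2 A"
  by (simp add: mat2_simps algebra_simps)

lemma adj2_adj2 [simp]: "adj2 (adj2 A) = A"
  by (simp add: mat2_simps)

lemma adj2_minus [simp]: "adj2 (- A) = - adj2 A"
  by (simp add: mat2_simps)

lemma trace_adj2 [simp]: "trace (adj2 A) = trace A"
  by (simp add: mat2_simps algebra_simps)

lemma det_adj2 [simp]: "det (adj2 A) = det A"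
  by (simp add: mat2_simps algebra_simps)

text \<open>Cayley-Hamilton for \<open>A\<close>, multiplied by \<open>B\<close> and traced.\<close>

lemma trace_mult_mult2: "trace (A ** (A ** B)) = trace A * trace (A ** B) - det A * trace (B :: 'a::comm_ring_1^2^2)"
  by (simp add: mat2_simps algebra_simps)

lemma trace_mpow2:
  fixes A :: "'a::comm_ring_1^2^2"
  assumes "det A = 1"
  shows "trace (mpow A k) = cheb (trace A) k"
proof (induction "trace A" k rule: cheb.induct)
  case 1
  show ?case by (simp add: mat2_simps)
next
  case (3 k)
  then show ?case using assms by (simp add: trace_mult_mult2)
qed simp

text \<open>Fricke's identity. It is expanded with the determinants kept, where it is a polynomial
  identity in the entries.\<close>

lemma trace_commutator2:
  fixes A B :: "'a::comm_ring_1^2^2"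
  assumes "det A = 1" "det B = 1"
  shows "trace (A ** B ** adj2 A ** adj2 B) =
    trace A ^ 2 + trace B ^ 2 + trace (A ** B) ^ 2 - trace A * trace B * trace (A ** B) - 2"
proof -
  have "trace (A ** B ** adj2 A ** adj2 B) =
    det B * trace A ^ 2 + det A * trace B ^ 2 + trace (A ** B) ^ 2
     - trace A * trace B * trace (A ** B) - 2 * det A * det B"
    by (simp add: mat2_simps power2_eq_square algebra_simps)
  then show ?thesis by (simp add: assms)
qed

text \<open>Replacing the left factor \<open>B\<close> by its trace minus \<open>adj2 B\<close>
  leaves the commutator up to cyclic order.\<close>

lemma trace_conjugate2:
  fixes A B :: "'a::comm_ring_1^2^2"
  assumes "det A = 1" "det B = 1"
  shows "trace (B ** (A ** B ** adj2 A)) = trace B ^ 2 - trace (A ** B ** adj2 A ** adj2 B)"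
proof -
  have "trace (B ** (A ** B ** adj2 A)) = det A * trace B ^ 2 - trace (A ** B ** adj2 A ** adj2 B)"
    by (simp add: mat2_simps power2_eq_square algebra_simps)
  then show ?thesis by (simp add: assms)
qed

lemma minus_mult_matrix: "(- A) ** B = - (A ** (B :: 'a::comm_ring_1^'n^'n))"
  "A ** (- B) = - (A ** B)"
  by (simp_all add: vec_eq_iff matrix_matrix_mult_def sum_negf)

lemma trace_minus: "trace (- A) = - trace (A :: 'a::comm_ring_1^'n^'n)"
  by (simp add: trace_def sum_negf)

text \<open>If \<open>H\<close> and \<open>K\<close> commuted, their commutator would have trace 2;
  Fricke's identity, applied twice, turns this into the vanishing of a product of factors assumed
  nonzero. If they anticommuted, \<open>K\<close> would be conjugate to its negative and have trace
  0. The second case matters because words are evaluated only up to sign.\<close>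

lemma commutator_not_commuting2:
  fixes A B :: "'a::{idom,ring_char_0}^2^2"
  defines "H \<equiv> A ** B ** adj2 A ** adj2 B"
  defines "K \<equiv> A ** H ** adj2 A"
  assumes det: "det A = 1" "det B = 1"
    and nz: "trace H \<noteq> 0" "trace H \<noteq> 2" "trace A \<noteq> 0" "trace A ^ 2 \<noteq> trace H + 2"
  shows "H ** K \<noteq> K ** H" "H ** K \<noteq> - (K ** H)"
proof -
  have detH: "det H = 1" and detK: "det K = 1"
    by (simp_all add: H_def K_def det_mul det)
  have trK: "trace K = trace H"
    unfolding K_def by (subst trace_mul_sym) (simp add: matrix_mul_assoc adj2_mult det)
  \<comment> \<open>Here \<open>A ** H\<close> is \<open>A ** A\<close> times a conjugate of
    \<open>adj2 A\<close>, so \<open>trace_mult_mult2\<close> applies.\<close>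
  have AH: "trace (A ** H) = trace A * trace H - trace A"
  proof -
    have "trace (A ** (A ** (B ** adj2 A ** adj2 B))) = trace A * trace H - trace (B ** adj2 A ** adj2 B)"
      by (simp only: trace_mult_mult2 det) (simp add: H_def matrix_mul_assoc)
    moreover have "trace (B ** adj2 A ** adj2 B) = trace A"
      by (subst trace_mul_sym) (simp add: matrix_mul_assoc adj2_mult det)
    ultimately show ?thesis by (simp add: H_def matrix_mul_assoc)
  qed
  have HK: "trace (H ** K) = trace H ^ 2 - trace (A ** H ** adj2 A ** adj2 H)"
    unfolding K_def by (rule trace_conjugate2[OF det(1) detH])
  have "trace (A ** H ** adj2 A ** adj2 H) =
      trace A ^ 2 + trace H ^ 2 + trace (A ** H) ^ 2 - trace A * trace H * trace (A ** H) - 2"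
    by (rule trace_commutator2[OF det(1) detH])
  also have "\<dots> = (trace H - 2) * (trace H + 2 - trace A ^ 2) + 2"
    unfolding AH by algebra
  finally have u: "trace (H ** K) = trace H ^ 2 - 2 - (trace H - 2) * (trace H + 2 - trace A ^ 2)"
    using HK by simp
  show "H ** K \<noteq> K ** H"
  proof
    assume eq: "H ** K = K ** H"
    have "H ** K ** adj2 H ** adj2 K = K ** (H ** adj2 H) ** adj2 K"
      unfolding eq by (simp add: matrix_mul_assoc)
    then have "trace (H ** K ** adj2 H ** adj2 K) = 2"
      by (simp add: adj2_mult detH detK) (simp add: mat2_simps)
    then have e: "2 * trace H ^ 2 + trace (H ** K) ^ 2 - trace H ^ 2 * trace (H ** K) - 2 = 2"
      unfolding trace_commutator2[OF detH detK] trK by (simp add: power2_eq_square)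
    have "(trace H - 2) * (trace A ^ 2 * ((trace H - 2) * (trace H + 2 - trace A ^ 2))) =
        2 - (2 * trace H ^ 2 + trace (H ** K) ^ 2 - trace H ^ 2 * trace (H ** K) - 2)"
      unfolding u by (simp add: algebra_simps power2_eq_square)
    also have "\<dots> = 0" unfolding e by simp
    finally show False using nz by auto
  qed
  show "H ** K \<noteq> - (K ** H)"
  proof
    assume eq: "H ** K = - (K ** H)"
    have "adj2 H ** H ** K = - (adj2 H ** K ** H)"
      using eq by (metis matrix_mul_assoc minus_mult_matrix(2))
    then have "K = - (adj2 H ** K ** H)" by (simp add: adj2_mult detH)
    then have "trace K = - trace (adj2 H ** K ** H)" by (metis trace_minus)
    also have "trace (adj2 H ** K ** H) = trace K"
      by (subst trace_mul_sym) (simp add: matrix_mul_assoc adj2_mult detH)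
    finally show False using trK nz by (metis eq_neg_iff_add_eq_0 mult_2 mult_eq_0_iff zero_neq_numeral)
  qed
qed

text \<open>The eigenvalues are exp(i theta) and exp(-i theta), so the quotients sin(k theta) /
  sin(theta) solve the recurrence for the powers. The factor sin(theta) stays on the left to avoid
  division.\<close>

lemma mpow_rotation2:
  fixes A :: "complex^2^2"
  assumes "det A = 1" "trace A = of_real (2 * cos \<theta>)" "sin \<theta> \<noteq> 0"
  shows "of_real (sin \<theta>) * mpow A k $ i $ j =
    of_real (sin (real k * \<theta>)) * A $ i $ j - of_real (sin ((real k - 1) * \<theta>)) * mat 1 $ i $ j"
proof (induction k arbitrary: i j)
  case 0
  show ?case by simp
next
  case (Suc k)
  have A2: "(A ** A) $ i $ j = of_real (2 * cos \<theta>) * A $ i $ j - mat 1 $ i $ j"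
  proof -
    have "(A ** A) $ i $ j = trace A * A $ i $ j - det A * mat 1 $ i $ j"
      using exhaust_2[of i] exhaust_2[of j] by (auto simp: mat2_simps algebra_simps)
    then show ?thesis by (simp add: assms)
  qed
  have s: "sin (real (Suc k) * \<theta>) = 2 * cos \<theta> * sin (real k * \<theta>) - sin ((real k - 1) * \<theta>)"
    by (simp add: algebra_simps sin_add sin_diff)
  have "of_real (sin \<theta>) * mpow A (Suc k) $ i $ j
      = (\<Sum>l\<in>UNIV. A $ i $ l * (of_real (sin \<theta>) * mpow A k $ l $ j))"
    by (simp add: matrix_matrix_mult_def sum_distrib_left mult_ac)
  also have "\<dots> = of_real (sin (real k * \<theta>)) * (A ** A) $ i $ j
      - of_real (sin ((real k - 1) * \<theta>)) * (A ** mat 1) $ i $ j"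
    unfolding Suc by (simp add: matrix_matrix_mult_def sum_subtractf sum_distrib_left algebra_simps)
  finally show ?case
    unfolding A2 s by (simp add: algebra_simps)
qed

text \<open>The formula for powers collapses to cos(n theta) times the identity, and this cosine is
  1 or -1.\<close>

lemma mpow_rotation2_eq:
  fixes A :: "complex^2^2"
  assumes "det A = 1" "trace A = of_real (2 * cos \<theta>)" "sin \<theta> \<noteq> 0" "sin (real n * \<theta>) = 0"
  shows "mpow A n = mat 1 \<or> mpow A n = - mat 1"
proof -
  have s: "sin ((real n - 1) * \<theta>) = - cos (real n * \<theta>) * sin \<theta>"
    using assms(4) by (simp add: algebra_simps sin_diff)
  have "of_real (sin \<theta>) * mpow A n $ i $ j = of_real (sin \<theta>) * (of_real (cos (real n * \<theta>)) * mat 1 $ i $ j)" for i j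
    unfolding mpow_rotation2[OF assms(1-3)] s assms(4) by simp
  then have "mpow A n $ i $ j = of_real (cos (real n * \<theta>)) * mat 1 $ i $ j" for i j
    using assms(3) by simp
  moreover have "cos (real n * \<theta>) = 1 \<or> cos (real n * \<theta>) = -1"
    using sin_cos_squared_add[of "real n * \<theta>"] assms(4) power2_eq_1_iff by auto
  ultimately show ?thesis by (auto simp: vec_eq_iff)
qed

text \<open>The difference of the two sides is 4 times the product of the cosines of the four half
  sums with at most one sign changed, all angles strictly between -pi/2 and pi/2. It is minus the
  determinant of the Gram matrix of a hyperbolic triangle.\<close>

lemma sum_squares_cos_gt_1:
  fixes \<alpha> \<beta> \<gamma> :: real
  assumes "0 < \<alpha>" "\<alpha> \<le> pi/2" "0 < \<beta>" "\<beta> \<le> pi/2" "0 < \<gamma>" "\<gamma> \<le> pi/2" "\<alpha> + \<beta> + \<gamma> < pi"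
  shows "cos \<alpha> ^ 2 + cos \<beta> ^ 2 + cos \<gamma> ^ 2 + 2 * cos \<alpha> * cos \<beta> * cos \<gamma> > 1"
proof -
  have cc: "2 * cos u * cos v = cos s + cos d" if "u + v = s" "u - v = d" for u v s d :: real
    unfolding that[symmetric] by (simp add: cos_add cos_diff)
  let ?p = "cos ((\<alpha>+\<beta>+\<gamma>)/2)" and ?q = "cos ((\<alpha>+\<beta>-\<gamma>)/2)"
    and ?r = "cos ((\<gamma>+\<alpha>-\<beta>)/2)" and ?s = "cos ((\<gamma>-\<alpha>+\<beta>)/2)"
  have "?p > 0" "?q > 0" "?r > 0" "?s > 0"
    using assms by (auto intro!: cos_gt_zero_pi)
  then have "0 < (2 * ?p * ?q) * (2 * ?r * ?s)" by simp
  also have "2 * ?p * ?q = cos (\<alpha> + \<beta>) + cos \<gamma>" by (rule cc) (simp_all add: field_simps)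
  also have "2 * ?r * ?s = cos \<gamma> + cos (\<alpha> - \<beta>)"
    by (rule cc) (simp_all add: field_simps)
  also have "(cos (\<alpha> + \<beta>) + cos \<gamma>) * (cos \<gamma> + cos (\<alpha> - \<beta>)) =
     cos \<gamma> ^ 2 + 2 * cos \<alpha> * cos \<beta> * cos \<gamma> + (cos \<alpha> ^2 * cos \<beta> ^2 - sin \<alpha> ^ 2 * sin \<beta> ^ 2)"
    by (simp add: cos_add cos_diff power2_eq_square algebra_simps)
  also have "cos \<alpha> ^2 * cos \<beta> ^2 - sin \<alpha> ^ 2 * sin \<beta> ^ 2 = cos \<alpha> ^ 2 + cos \<beta> ^ 2 - 1"
    unfolding sin_squared_eq by algebra
  finally show ?thesis by simp
qed

section \<open>Commutators in hyperbolic triangle groups\<close>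

lemma triangle_matrices:
  fixes p q r :: nat
  assumes "p \<ge> 2" "q \<ge> 2" "r \<ge> 2" and hyp: "1 / real p + 1 / real q + 1 / real r < 1"
  obtains A B :: "complex^2^2" and x y \<tau> :: real
  where "det A = 1" "det B = 1"
    "mpow A p = mat 1 \<or> mpow A p = - mat 1"
    "mpow B q = mat 1 \<or> mpow B q = - mat 1"
    "mpow (adj2 (A ** B)) r = mat 1 \<or> mpow (adj2 (A ** B)) r = - mat 1"
    "trace A = of_real x" "trace B = of_real y" "x ^ 2 < 4" "y ^ 2 < 4" "x \<noteq> 0 \<or> y \<noteq> 0"
    "trace (A ** B ** adj2 A ** adj2 B) = of_real \<tau>" "\<tau> > 2"
proof -
  define \<alpha> \<beta> \<gamma> where "\<alpha> = pi / p" and "\<beta> = pi / q" and "\<gamma> = pi / r"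
  have bd: "0 < pi / real m" "pi / real m \<le> pi / 2" if "m \<ge> 2" for m :: nat
    using that by (auto simp: field_simps intro: mult_left_mono)
  have sin0: "sin (pi / real m) \<noteq> 0" if "m \<ge> 2" for m :: nat
    using sin_gt_zero[of "pi / real m"] bd[OF that] pi_gt_zero by linarith
  have cos4: "(2 * cos (pi / real m)) ^ 2 < 4" if "m \<ge> 2" for m :: nat
    using sin0[OF that] by (simp add: power_mult_distrib cos_squared_eq)
  have "\<alpha> + \<beta> + \<gamma> = pi * (1 / real p + 1 / real q + 1 / real r)"
    by (simp add: \<alpha>_def \<beta>_def \<gamma>_def algebra_simps)
  also have "\<dots> < pi * 1" using hyp by (intro mult_strict_left_mono) auto
  finally have sum: "\<alpha> + \<beta> + \<gamma> < pi" by simp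
  \<comment> \<open>The angle \<open>pi - \<gamma>\<close> makes the third trace nonpositive, so
    that the product term in Fricke's identity adds to the squares.\<close>
  define x y z where "x = 2 * cos \<alpha>" and "y = 2 * cos \<beta>" and "z = 2 * cos (pi - \<gamma>)"
  define t where "t = cis (pi - \<gamma>)"
  have t0: "t \<noteq> 0" by (simp add: t_def)
  have tt: "t + inverse t = of_real z"
    by (simp add: t_def z_def cis_inverse complex_eq_iff)
  \<comment> \<open>\<open>A\<close> is a companion matrix, and \<open>B\<close> is chosen so that
    \<open>A ** B\<close> is upper triangular with diagonal entries \<open>inverse t\<close> and
    \<open>t\<close>; this prescribes all three traces.\<close>
  define A B :: "complex^2^2" where "A = vector [vector [of_real x, -1], vector [1, 0]]"
    and "B = vector [vector [0, t], vector [- inverse t, of_real y]]"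
  have det: "det A = 1" "det B = 1" using t0 by (simp_all add: A_def B_def det_2)
  have tr: "trace A = of_real x" "trace B = of_real y" "trace (A ** B) = of_real z"
    using tt by (simp_all add: A_def B_def mat2_simps add.commute)
  define \<tau> where "\<tau> = x ^ 2 + y ^ 2 + z ^ 2 - x * y * z - 2"
  have trC: "trace (A ** B ** adj2 A ** adj2 B) = of_real \<tau>"
    unfolding trace_commutator2[OF det] tr \<tau>_def by simp
  have "\<tau> = 4 * (cos \<alpha> ^ 2 + cos \<beta> ^ 2 + cos \<gamma> ^ 2 + 2 * cos \<alpha> * cos \<beta> * cos \<gamma>) - 2"
    by (simp add: \<tau>_def x_def y_def z_def power2_eq_square)
  also have "\<dots> > 2"
    using sum_squares_cos_gt_1[of \<alpha> \<beta> \<gamma>] bd assms(1-3) sum unfolding \<alpha>_def \<beta>_def \<gamma>_def by simp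
  finally have \<tau>: "\<tau> > 2" .
  have A: "mpow A p = mat 1 \<or> mpow A p = - mat 1"
    by (rule mpow_rotation2_eq[of _ \<alpha>]) (use assms sin0 in \<open>auto simp: det tr x_def \<alpha>_def\<close>)
  have B: "mpow B q = mat 1 \<or> mpow B q = - mat 1"
    by (rule mpow_rotation2_eq[of _ \<beta>]) (use assms sin0 in \<open>auto simp: det tr y_def \<beta>_def\<close>)
  have C: "mpow (adj2 (A ** B)) r = mat 1 \<or> mpow (adj2 (A ** B)) r = - mat 1"
  proof (rule mpow_rotation2_eq[of _ "pi - \<gamma>"])
    have "real r * (pi - \<gamma>) = real r * pi - pi"
      using assms by (simp add: \<gamma>_def algebra_simps)
    then show "sin (real r * (pi - \<gamma>)) = 0"
      by (simp add: sin_diff)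
  qed (use assms sin0 in \<open>auto simp: det_mul det tr z_def \<gamma>_def\<close>)
  \<comment> \<open>If both traces vanished, the commutator would have trace
    \<open>z ^ 2 - 2\<close>, which is less than 2.\<close>
  have "x \<noteq> 0 \<or> y \<noteq> 0"
  proof (rule ccontr)
    assume "\<not> (x \<noteq> 0 \<or> y \<noteq> 0)"
    then have "z ^ 2 > 4" using \<tau> by (simp add: \<tau>_def)
    moreover have "z ^ 2 < 4" using cos4[of r] assms by (simp add: z_def \<gamma>_def)
    ultimately show False by simp
  qed
  then show thesis
    using that[OF det A B C tr(1,2) _ _ _ trC \<tau>] cos4 assms by (simp add: x_def y_def \<alpha>_def \<beta>_def)
qed

section \<open>Words evaluated in SL_2(C), up to sign\<close>

primrec eval_word :: "('s \<Rightarrow> complex^2^2) \<Rightarrow> 's word \<Rightarrow> complex^2^2" where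
  "eval_word M [] = mat 1"
| "eval_word M (x # u) = (if snd x then M (fst x) else adj2 (M (fst x))) ** eval_word M u"

lemma eval_word_append: "eval_word M (u @ v) = eval_word M u ** eval_word M v"
  by (induction u) (simp_all add: matrix_mul_assoc)

lemma eval_word_concat_replicate: "eval_word M (concat (replicate k u)) = mpow (eval_word M u) k"
  by (induction k) (simp_all add: eval_word_append)

lemma eval_word_replicate: "eval_word M (replicate k (s, True)) = mpow (M s) k"
  by (induction k) simp_all

text \<open>A lift to SL_2(C) of a rotation of order n may have n-th power -1, so relators are
  respected only up to sign. Signs are central and pass through products.\<close>

lemma eval_word_eq:
  assumes "word_eq R u v" "\<And>s. det (M s) = 1"
    and "\<And>r. r \<in> R \<Longrightarrow> eval_word M r = mat 1 \<or> eval_word M r = - mat 1"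
  shows "eval_word M u = eval_word M v \<or> eval_word M u = - eval_word M v"
  using assms(1)
proof (induction rule: word_eq.induct)
  case (append u u' v v')
  then show ?case by (auto simp: eval_word_append minus_mult_matrix)
next
  case (cancel s b)
  then show ?case by (auto simp: adj2_mult assms(2))
qed (use assms(3) in auto)

definition commutator_word :: "cone word" where
  "commutator_word = [(C1, True), (C2, True), (C1, False), (C2, False)]"

text \<open>An equality of words would hold up to sign for the triangle group in SL_2(C), where the
  commutator has real trace above 2.\<close>

lemma commutator_word_props:
  assumes T: "turnover T" and \<chi>: "orbifold_euler_char T < 0"
  defines "R \<equiv> turnover_relators T"
  shows "k > 0 \<Longrightarrow> \<not> word_eq R (concat (replicate k commutator_word)) []"
    and "\<exists>s\<in>{C1, C2}. \<not> word_eq R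
      (commutator_word @ [(s, True)] @ commutator_word @ [(s, False)])
      ([(s, True)] @ commutator_word @ [(s, False)] @ commutator_word)"
proof -
  define p q r where "p = cone_order T C1" and "q = cone_order T C2" and "r = cone_order T C3"
  have ge: "p \<ge> 2" "q \<ge> 2" "r \<ge> 2" using T by (auto simp: turnover_def p_def q_def r_def)
  have "1 / real p + 1 / real q + 1 / real r < 1"
    using \<chi> by (simp add: orbifold_euler_char_def p_def q_def r_def)
  then obtain A B :: "complex^2^2" and x y \<tau> :: real
    where det: "det A = 1" "det B = 1"
    and A: "mpow A p = mat 1 \<or> mpow A p = - mat 1"
    and B: "mpow B q = mat 1 \<or> mpow B q = - mat 1"
    and C: "mpow (adj2 (A ** B)) r = mat 1 \<or> mpow (adj2 (A ** B)) r = - mat 1"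
    and tr: "trace A = of_real x" "trace B = of_real y"
    and xy: "x ^ 2 < 4" "y ^ 2 < 4" "x \<noteq> 0 \<or> y \<noteq> 0"
    and trC: "trace (A ** B ** adj2 A ** adj2 B) = of_real \<tau>" and \<tau>: "\<tau> > 2"
    by (rule triangle_matrices[OF ge])
  define M where "M = (\<lambda>i. case i of C1 \<Rightarrow> A | C2 \<Rightarrow> B | C3 \<Rightarrow> adj2 (A ** B))"
  have M [simp]: "M C1 = A" "M C2 = B" "M C3 = adj2 (A ** B)" by (simp_all add: M_def)
  have detM: "det (M s) = 1" for s by (cases s) (simp_all add: det det_mul)
  have rel: "eval_word M w = mat 1 \<or> eval_word M w = - mat 1" if w: "w \<in> R" for w
  proof -
    from w consider "w = [(C1, True), (C2, True), (C3, True)]" | i where "w = replicate (cone_order T i) (i, True)"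
      unfolding R_def turnover_relators_def by auto
    then show ?thesis
    proof cases
      case 1
      then show ?thesis by (simp add: matrix_mul_assoc adj2_mult det det_mul)
    next
      case (2 i)
      then show ?thesis using A B C
        by (cases i) (auto simp: eval_word_replicate p_def q_def r_def)
    qed
  qed
  define H where "H = A ** B ** adj2 A ** adj2 B"
  have evH: "eval_word M commutator_word = H"
    by (simp add: commutator_word_def H_def matrix_mul_assoc)
  have detH: "det H = 1" by (simp add: H_def det det_mul)
  have trH: "trace H = of_real \<tau>" using trC by (simp add: H_def)
  note ev = eval_word_eq[OF _ detM rel]
  show "\<not> word_eq R (concat (replicate k commutator_word)) []" if k: "k > 0"
  proof
    assume "word_eq R (concat (replicate k commutator_word)) []"
    from ev[OF this] have "mpow H k = mat 1 \<or> mpow H k = - mat 1"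
      by (simp add: eval_word_concat_replicate evH)
    then have "trace (mpow H k) = 2 \<or> trace (mpow H k) = - 2"
      by (auto simp: mat2_simps)
    moreover have "trace (mpow H k) = of_real (cheb \<tau> k)"
      by (simp add: trace_mpow2[OF detH] trH cheb_of_real)
    ultimately have "cheb \<tau> k = 2 \<or> cheb \<tau> k = - 2"
      by (metis of_real_eq_iff of_real_minus of_real_numeral)
    then show False using abs_cheb_gt_2[of \<tau> k] \<tau> k by auto
  qed
  have nzH: "trace H \<noteq> 0" "trace H \<noteq> 2"
    using \<tau> by (auto simp: trH complex_eq_iff)
  \<comment> \<open>The square of the trace of an elliptic generator is below 4, while the trace of
    \<open>H\<close> plus 2 exceeds 4.\<close>
  have nz2: "(of_real u :: complex) ^ 2 \<noteq> trace H + 2" if "u ^ 2 < 4" for u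
    using that \<tau> by (auto simp: trH complex_eq_iff simp flip: of_real_power)
  show "\<exists>s\<in>{C1, C2}. \<not> word_eq R
      (commutator_word @ [(s, True)] @ commutator_word @ [(s, False)])
      ([(s, True)] @ commutator_word @ [(s, False)] @ commutator_word)"
  \<comment> \<open>The criterion fails for a conjugating element of trace 0, a rotation of order 2;
    then the other generator serves.\<close>
  proof (cases "x = 0")
    case False
    have "\<not> word_eq R (commutator_word @ [(C1, True)] @ commutator_word @ [(C1, False)])
      ([(C1, True)] @ commutator_word @ [(C1, False)] @ commutator_word)" (is "\<not> word_eq R ?u ?v")
    proof
      assume "word_eq R ?u ?v"
      from ev[OF this]
      have "H ** (A ** H ** adj2 A) = (A ** H ** adj2 A) ** H \<or>
        H ** (A ** H ** adj2 A) = - ((A ** H ** adj2 A) ** H)"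
        by (simp add: eval_word_append evH matrix_mul_assoc)
      with commutator_not_commuting2[OF det, folded H_def] nzH nz2[OF xy(1)] False
      show False by (simp add: tr)
    qed
    then show ?thesis by blast
  next
    case True
    define K where "K = B ** adj2 H ** adj2 B"
    \<comment> \<open>Exchanging \<open>A\<close> and \<open>B\<close> inverts the commutator, so
      the criterion now speaks of \<open>adj2 H\<close>, and the relation between words is inverted
      to match.\<close>
    have H': "B ** A ** adj2 B ** adj2 A = adj2 H"
      by (simp add: H_def adj2_mult_distrib matrix_mul_assoc)
    have "\<not> word_eq R (commutator_word @ [(C2, True)] @ commutator_word @ [(C2, False)])
      ([(C2, True)] @ commutator_word @ [(C2, False)] @ commutator_word)" (is "\<not> word_eq R ?u ?v")
    proof
      assume "word_eq R ?u ?v"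
      from ev[OF this]
      have "H ** (B ** H ** adj2 B) = (B ** H ** adj2 B) ** H \<or>
        H ** (B ** H ** adj2 B) = - ((B ** H ** adj2 B) ** H)"
        by (simp add: eval_word_append evH matrix_mul_assoc)
      then have "adj2 (H ** (B ** H ** adj2 B)) = adj2 ((B ** H ** adj2 B) ** H) \<or>
        adj2 (H ** (B ** H ** adj2 B)) = - adj2 ((B ** H ** adj2 B) ** H)"
        by (elim disjE) (simp_all only: adj2_minus simp_thms)
      then have "adj2 H ** K = K ** adj2 H \<or> adj2 H ** K = - (K ** adj2 H)"
        by (auto simp: adj2_mult_distrib K_def matrix_mul_assoc)
      with commutator_not_commuting2[OF det(2,1), unfolded H', folded K_def] nzH nz2[OF xy(2)] True xy(3)
      show False by (simp add: tr)
    qed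
    then show ?thesis by blast
  qed
qed

section \<open>Matrices in dimension 3 fixing a covector\<close>

lemma dot_matrix_vector: "x \<bullet> (A *v y) = (x v* A) \<bullet> y" for A :: "real^'n^'m"
  by (simp add: dot_lmul_matrix)

lemma fixed_covector_dot:
  fixes g :: "real^'n^'n"
  assumes "\<phi> v* g = \<phi>"
  shows "\<phi> \<bullet> (g *v x) = \<phi> \<bullet> x"
  using assms by (simp add: dot_matrix_vector)

lemma mpow_Suc_right: "mpow A (Suc k) = mpow A k ** A"
  using mpow_add[of A k 1] by simp

lemma transpose_mpow: "transpose (mpow A k) = mpow (transpose A) k"
proof (induction k)
  case (Suc k)
  have "transpose (mpow A (Suc k)) = mpow (transpose A) k ** transpose A"
    by (simp add: matrix_transpose_mul Suc)
  then show ?case by (simp only: mpow_Suc_right)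
qed (simp add: transpose_mat)

lemma det_block_axis3:
  fixes g :: "real^3^3"
  assumes "axis 3 1 v* g = axis 3 1"
  shows "g$3$1 = 0" "g$3$2 = 0" "g$3$3 = 1"
  using assms by (simp_all add: vec_eq_iff forall_3 vector_matrix_mult_def sum_3 axis_def)

text \<open>An orthogonal map takes the direction of \<open>\<phi>\<close> to the third axis. A
  matrix fixing \<open>\<phi>\<close> then has last row (0, 0, 1), and its upper left 2x2 block is
  its action on the kernel of \<open>\<phi>\<close>.\<close>

lemma conjugate_to_axis3:
  fixes \<phi> :: "real^3"
  assumes "\<phi> \<noteq> 0"
  obtains Q where "transpose Q ** Q = mat 1" "Q ** transpose Q = mat 1"
    "\<And>g. \<phi> v* g = \<phi> \<Longrightarrow> axis 3 1 v* (Q ** g ** transpose Q) = (axis 3 1 :: real^3)"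
    "\<And>w. \<phi> \<bullet> w = 0 \<Longrightarrow> (Q *v w)$3 = 0"
proof -
  have "norm \<phi> = norm (axis 3 (norm \<phi>) :: real^3)"
    by (simp add: norm_vec_def L2_set_def sum_3 axis_def)
  then obtain f where f: "orthogonal_transformation f" "f \<phi> = (axis 3 (norm \<phi>) :: real^3)"
    by (rule orthogonal_transformation_exists)
  define Q where "Q = matrix f"
  have "orthogonal_matrix Q" and lin: "linear f"
    using f(1) by (auto simp: Q_def orthogonal_transformation_matrix)
  then have Q: "transpose Q ** Q = mat 1" "Q ** transpose Q = mat 1"
    by (auto simp: orthogonal_matrix_def)
  have "Q *v \<phi> = axis 3 (norm \<phi>)"
    using f(2) lin by (simp add: Q_def matrix_works)
  also have "\<dots> = norm \<phi> *\<^sub>R axis 3 1" by (simp add: vec_eq_iff axis_def)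
  finally have "Q *v \<phi> = norm \<phi> *\<^sub>R axis 3 1" .
  then have e3: "axis 3 1 = (1 / norm \<phi>) *\<^sub>R (Q *v \<phi>)" using assms by simp
  have ax: "axis 3 1 v* Q = (1 / norm \<phi>) *\<^sub>R \<phi>"
  proof -
    have "(Q *v \<phi>) v* Q = transpose Q *v (Q *v \<phi>)" by simp
    also have "\<dots> = \<phi>" by (simp only: matrix_vector_mul_assoc Q matrix_vector_mul_lid)
    finally show ?thesis unfolding e3 by (simp add: scaleR_vector_matrix_assoc)
  qed
  show thesis
  proof (rule that[OF Q])
    fix g assume "\<phi> v* g = \<phi>"
    then have "((axis 3 1 v* Q) v* g) v* transpose Q = (axis 3 1 v* Q) v* transpose Q"
      by (simp add: ax scaleR_vector_matrix_assoc del: vector_transpose_matrix)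
    then show "axis 3 1 v* (Q ** g ** transpose Q) = axis 3 1"
      by (simp only: vector_matrix_mul_assoc matrix_mul_assoc Q vector_matrix_mul_rid)
  next
    fix w assume w: "\<phi> \<bullet> w = 0"
    have "(Q *v w)$3 = axis 3 1 \<bullet> (Q *v w)" by (simp add: inner_axis')
    also have "\<dots> = 0" by (simp add: dot_matrix_vector ax w)
    finally show "(Q *v w)$3 = 0" .
  qed
qed

lemma det_conjugate:
  fixes Q g :: "real^'n^'n"
  assumes "Q ** transpose Q = mat 1"
  shows "det (Q ** g ** transpose Q) = det g"
proof -
  have "det Q * det (transpose Q) = 1" using assms by (metis det_mul det_I)
  then show ?thesis by (simp add: det_mul mult.commute mult.left_commute)
qed

lemma trace_conjugate:
  fixes Q g :: "real^'n^'n"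
  assumes "transpose Q ** Q = mat 1"
  shows "trace (Q ** g ** transpose Q) = trace g"
  by (subst trace_mul_sym) (simp add: matrix_mul_assoc assms)

text \<open>The action on the quotient by the kernel of \<open>\<phi>\<close> is trivial, so on this
  plane \<open>g\<close> has determinant 1 and trace \<open>trace g - 1\<close>.\<close>

lemma cayley_hamilton_fixed_covector:
  fixes g :: "real^3^3"
  assumes "\<phi> \<noteq> 0" and fx: "\<phi> v* g = \<phi>" and det: "det g = 1" and w: "\<phi> \<bullet> w = 0"
  shows "g *v (g *v w) = (trace g - 1) *\<^sub>R (g *v w) - w"
proof -
  have special: "g *v (g *v w) = (trace g - 1) *\<^sub>R (g *v w) - w"
    if "axis 3 1 v* g = axis 3 1" "det g = 1" "w$3 = 0" for g :: "real^3^3" and w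
  proof -
    have d: "g$1$1 * g$2$2 = 1 + g$1$2 * g$2$1"
      using that by (simp add: det_3 det_block_axis3[OF that(1)])
    have "g$1$1 * (g$2$2 * w$1) = w$1 + g$1$2 * (g$2$1 * w$1)"
      "g$1$1 * (g$2$2 * w$2) = w$2 + g$1$2 * (g$2$1 * w$2)"
      by (simp_all add: d distrib_right flip: mult.assoc)
    then show ?thesis
      by (simp add: vec_eq_iff forall_3 matrix_vector_mult_def sum_3 trace_def that(3)
        det_block_axis3[OF that(1)] algebra_simps)
  qed
  obtain Q where Q: "transpose Q ** Q = mat 1" "Q ** transpose Q = mat 1"
    "\<And>g. \<phi> v* g = \<phi> \<Longrightarrow> axis 3 1 v* (Q ** g ** transpose Q) = (axis 3 1 :: real^3)"
    "\<And>w. \<phi> \<bullet> w = 0 \<Longrightarrow> (Q *v w)$3 = 0"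
    using conjugate_to_axis3[OF assms(1)] by blast
  define g' where "g' = Q ** g ** transpose Q"
  have g': "g' *v (Q *v x) = Q *v (g *v x)" for x
    by (simp only: g'_def matrix_vector_mul_assoc) (simp only: Q matrix_mul_rid flip: matrix_mul_assoc)
  have "g' *v (g' *v (Q *v w)) = (trace g' - 1) *\<^sub>R (g' *v (Q *v w)) - Q *v w"
    by (rule special) (simp_all add: g'_def Q fx det w det_conjugate)
  then have "Q *v (g *v (g *v w)) = Q *v ((trace g - 1) *\<^sub>R (g *v w) - w)"
    by (simp add: g' matrix_vector_mult_scaleR matrix_vector_mult_diff_distrib)
       (simp add: g'_def trace_conjugate Q)
  moreover have "transpose Q *v (Q *v x) = x" for x
    by (simp only: matrix_vector_mul_assoc Q matrix_vector_mul_lid)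
  ultimately show ?thesis by metis
qed

text \<open>The commutator \<open>A B - B A\<close> is orthogonal to \<open>A\<close> for the trace form, and the determinant is
  negative definite on the orthogonal complement of an elliptic element.\<close>

lemma elliptic_commutator2:
  fixes A B :: "real^2^2"
  assumes det: "det A = 1" "det B = 1" and ell: "\<bar>trace A\<bar> < 2"
    and tr: "trace (A ** B ** adj2 A ** adj2 B) \<le> 2"
  shows "A ** B = B ** A"
proof -
  define M where "M = A ** B - B ** A"
  define m x y d where "m = M$1$1" and "x = M$1$2" and "y = M$2$1" and "d = A$1$1 - A$2$2"
  have M22: "M$2$2 = - m"
    by (simp add: M_def m_def matrix_matrix_mult_def sum_2)
  have "det M = 2 * (det A * det B) - trace (A ** B ** adj2 A ** adj2 B)"
    by (simp add: M_def mat2_simps algebra_simps)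
  then have "det M \<ge> 0" using tr det by simp
  then have dM: "m ^ 2 + x * y \<le> 0"
    by (simp add: det_2 M22 power2_eq_square flip: m_def x_def y_def)
  have orth: "m * d + x * A$2$1 + y * A$1$2 = 0"
    by (simp add: m_def x_def y_def d_def M_def matrix_matrix_mult_def sum_2 algebra_simps)
  have "(trace A) ^ 2 < 4" using ell abs_square_less_1[of "trace A / 2"] by (simp add: power_divide)
  then have neg: "d ^ 2 + 4 * A$1$2 * A$2$1 < 0"
    using det(1) by (simp add: trace_def det_2 sum_2 d_def power2_eq_square algebra_simps)
  then have q0: "A$1$2 \<noteq> 0" by auto
  \<comment> \<open>Multiplying by the square of a nonzero entry lets \<open>orth\<close> eliminate
    \<open>y\<close>. Completing the square writes a nonpositive number as a sum of two nonnegative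
    terms, so both vanish.\<close>
  have "(A$1$2) ^ 2 * (m ^ 2 + x * y) = (A$1$2 * m) ^ 2 + A$1$2 * x * (y * A$1$2)"
    by (simp add: power2_eq_square algebra_simps)
  also have "y * A$1$2 = - (m * d + x * A$2$1)" using orth by simp
  finally have id: "(A$1$2) ^ 2 * (m ^ 2 + x * y) =
      (A$1$2 * m - x * d / 2) ^ 2 + x ^ 2 * (- (d ^ 2 + 4 * A$1$2 * A$2$1) / 4)"
    by (simp add: power2_eq_square field_simps)
  have "(A$1$2) ^ 2 * (m ^ 2 + x * y) \<le> 0" using dM by (simp add: mult_nonneg_nonpos)
  moreover have ge: "x ^ 2 * (- (d ^ 2 + 4 * A$1$2 * A$2$1) / 4) \<ge> 0" using neg by simp
  ultimately have "(A$1$2 * m - x * d / 2) ^ 2 \<le> 0" "x ^ 2 * (- (d ^ 2 + 4 * A$1$2 * A$2$1) / 4) \<le> 0"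
    using id zero_le_power2[of "A$1$2 * m - x * d / 2"] by linarith+
  moreover from this ge have "x ^ 2 * (- (d ^ 2 + 4 * A$1$2 * A$2$1) / 4) = 0" by linarith
  then have x0: "x = 0" using neg by simp
  ultimately have m0: "m = 0" using q0 by simp
  then have y0: "y = 0" using orth x0 q0 by simp
  have "M = 0" using m0 x0 y0 M22 by (simp add: vec_eq_iff forall_2 m_def x_def y_def)
  then show ?thesis by (simp add: M_def)
qed

text \<open>The 2x2 blocks after the change of basis are the actions on the kernel of
  \<open>\<phi>\<close>; there \<open>h\<close> is the commutator of \<open>a\<close> and
  \<open>b\<close>, and \<open>elliptic_commutator2\<close> applies.\<close>

lemma elliptic_commutator_fixed_covector:
  fixes a b h :: "real^3^3"
  assumes \<phi>: "\<phi> \<noteq> 0" "\<phi> v* a = \<phi>" "\<phi> v* b = \<phi>" "\<phi> v* h = \<phi>"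
    and det: "det a = 1" "det b = 1" and h: "h ** b ** a = a ** b"
    and ell: "\<bar>trace a - 1\<bar> < 2" and tr: "trace h - 1 \<le> 2" and w: "\<phi> \<bullet> w = 0"
  shows "a *v (b *v w) = b *v (a *v w)"
proof -
  obtain Q where Q: "transpose Q ** Q = mat 1" "Q ** transpose Q = mat 1"
    "\<And>g. \<phi> v* g = \<phi> \<Longrightarrow> axis 3 1 v* (Q ** g ** transpose Q) = (axis 3 1 :: real^3)"
    "\<And>w. \<phi> \<bullet> w = 0 \<Longrightarrow> (Q *v w)$3 = 0"
    using conjugate_to_axis3[OF \<phi>(1)] by blast
  define c where "c = (\<lambda>g. Q ** g ** transpose Q)"
  define L :: "real^3^3 \<Rightarrow> real^2^2" where
    "L = (\<lambda>g. vector [vector [c g$1$1, c g$1$2], vector [c g$2$1, c g$2$2]])"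
  have c: "c (g ** g') = c g ** c g'" for g g'
  proof -
    have "c g ** c g' = Q ** g ** (transpose Q ** Q) ** g' ** transpose Q"
      by (simp add: c_def matrix_mul_assoc)
    then show ?thesis by (simp add: Q c_def matrix_mul_assoc)
  qed
  have row: "c g$3$1 = 0" "c g$3$2 = 0" "c g$3$3 = 1" if "\<phi> v* g = \<phi>" for g
    using det_block_axis3[OF Q(3)[OF that]] by (simp_all add: c_def)
  have mult: "L (g ** g') = L g ** L g'" if "\<phi> v* g' = \<phi>" for g g'
    unfolding L_def c by (simp add: row[OF that] vec_eq_iff forall_2 matrix_matrix_mult_def sum_2 sum_3)
  have detL: "det (L g) = det g" if "\<phi> v* g = \<phi>" for g
  proof -
    have "det g = det (c g)" by (simp add: c_def det_conjugate Q)
    then show ?thesis by (simp add: det_3 det_2 row[OF that] L_def)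
  qed
  have trL: "trace (L g) = trace g - 1" if "\<phi> v* g = \<phi>" for g
  proof -
    have "trace g = trace (c g)" by (simp add: c_def trace_conjugate Q)
    then show ?thesis by (simp add: trace_def sum_2 sum_3 row[OF that] L_def)
  qed
  have "L h ** L b ** L a = L a ** L b"
    using h by (metis mult \<phi>(2,3))
  then have "L h ** (L b ** (L a ** adj2 (L a)) ** adj2 (L b)) = L a ** L b ** adj2 (L a) ** adj2 (L b)"
    by (metis matrix_mul_assoc)
  then have "L h = L a ** L b ** adj2 (L a) ** adj2 (L b)"
    by (simp add: adj2_mult detL det \<phi>)
  then have comm: "L a ** L b = L b ** L a"
    using elliptic_commutator2[of "L a" "L b"] detL trL \<phi> det ell tr by metis
  have act: "c g *v (Q *v x) = Q *v (g *v x)" for g x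
    by (simp only: c_def matrix_vector_mul_assoc) (simp only: Q matrix_mul_rid flip: matrix_mul_assoc)
  have "c (a ** b) *v (Q *v w) = c (b ** a) *v (Q *v w)"
  proof -
    have "L (a ** b) = L (b ** a)" by (simp add: mult \<phi> comm)
    then have "c (a ** b)$i$j = c (b ** a)$i$j" if "i \<in> {1, 2}" "j \<in> {1, 2}" for i j
      using that unfolding L_def by (auto simp: vec_eq_iff forall_2)
    moreover have "\<phi> v* (a ** b) = \<phi>" "\<phi> v* (b ** a) = \<phi>"
      using \<phi> by (simp_all flip: vector_matrix_mul_assoc)
    ultimately show ?thesis using Q(4)[OF w] row
      by (simp add: vec_eq_iff forall_3 matrix_vector_mult_def sum_3)
  qed
  then have "Q *v (a ** b *v w) = Q *v (b ** a *v w)"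
    by (simp only: act)
  moreover have "transpose Q *v (Q *v x) = x" for x
    by (simp only: matrix_vector_mul_assoc Q matrix_vector_mul_lid)
  ultimately have "a ** b *v w = b ** a *v w" by metis
  then show ?thesis by (simp only: matrix_vector_mul_assoc)
qed

text \<open>The vector form of x^(2k) + 1 = (x^k + x^(-k)) x^k with x + 1/x = t.\<close>

lemma linear_recurrence_cheb:
  fixes f :: "nat \<Rightarrow> 'a::real_vector"
  assumes "\<And>k. f (Suc (Suc k)) = t *\<^sub>R f (Suc k) - f k"
  shows "f (j + 2 * k) + f j = cheb t k *\<^sub>R f (j + k)"
proof (induction k arbitrary: j rule: less_induct)
  case (less k)
  consider "k = 0" | "k = Suc 0" | m where "k = Suc (Suc m)" by (metis not0_implies_Suc)
  then show ?case
  proof cases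
    case 3
    have "f (j + 2 * k) = t *\<^sub>R f (Suc j + 2 * Suc m) - f (Suc (Suc j) + 2 * m)"
      using assms[of "j + 2 * m + 2"] 3 by simp
    moreover have "f j = t *\<^sub>R f (Suc j) - f (Suc (Suc j))" using assms[of j] by simp
    ultimately have "f (j + 2 * k) + f j = t *\<^sub>R (f (Suc j + 2 * Suc m) + f (Suc j)) -
        (f (Suc (Suc j) + 2 * m) + f (Suc (Suc j)))"
      by (simp add: algebra_simps)
    also have "\<dots> = t *\<^sub>R (cheb t (Suc m) *\<^sub>R f (Suc j + Suc m)) - cheb t m *\<^sub>R f (Suc (Suc j) + m)"
      using less[of "Suc m" "Suc j"] less[of m "Suc (Suc j)"] 3 by simp
    finally show ?thesis using 3 by (simp add: algebra_simps)
  qed (simp_all add: scaleR_2 assms)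
qed

context
  fixes g :: "real^3^3" and \<phi> :: "real^3" and n :: nat
  assumes \<phi>: "\<phi> \<noteq> 0" and fixed: "\<phi> v* g = \<phi>" and det: "det g = 1"
    and n: "n > 0" and ord: "mpow g n = mat 1"
begin

text \<open>Up to the sign \<open>\<epsilon>\<close> the action on the kernel is unipotent, so the
  powers move \<open>w\<close> linearly in the exponent, and finite order kills the linear term. The
  exponent is doubled to remove the sign.\<close>

lemma finite_order_scalar_on_kernel:
  assumes t: "trace g - 1 = 2 * \<epsilon>" and \<epsilon>: "\<epsilon> \<in> {1, -1}" and w: "\<phi> \<bullet> w = 0"
  shows "g *v w = \<epsilon> *\<^sub>R w"
proof -
  have \<epsilon>2: "\<epsilon> * \<epsilon> = 1" using \<epsilon> by auto
  have CH: "g *v (g *v w) = (2 * \<epsilon>) *\<^sub>R (g *v w) - w"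
    using cayley_hamilton_fixed_covector[OF \<phi> fixed det w] t by simp
  have "mpow g k *v w = \<epsilon> ^ k *\<^sub>R (w + real k *\<^sub>R (\<epsilon> *\<^sub>R (g *v w) - w))" for k
  proof (induction k)
    case (Suc k)
    have "mpow g (Suc k) *v w = g *v (mpow g k *v w)"
      by (simp add: matrix_vector_mul_assoc)
    also have "\<dots> = \<epsilon> ^ k *\<^sub>R (g *v w + real k *\<^sub>R (\<epsilon> *\<^sub>R (g *v (g *v w)) - g *v w))"
      unfolding Suc by (simp add: matrix_vector_mult_scaleR matrix_vector_mult_diff_distrib
          matrix_vector_right_distrib)
    also have "g *v w + real k *\<^sub>R (\<epsilon> *\<^sub>R (g *v (g *v w)) - g *v w) =
        \<epsilon> *\<^sub>R (w + real (Suc k) *\<^sub>R (\<epsilon> *\<^sub>R (g *v w) - w))"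
      unfolding CH using \<epsilon> by (auto simp: vec_eq_iff algebra_simps)
    finally show ?case by (simp add: mult.commute)
  qed simp
  from this[of "n * 2"] have "w = (\<epsilon> ^ (n * 2)) *\<^sub>R (w + real (n * 2) *\<^sub>R (\<epsilon> *\<^sub>R (g *v w) - w))"
    by (simp only: mpow_mult ord mpow_mat_1 matrix_vector_mul_lid)
  also have "\<epsilon> ^ (n * 2) = 1" using \<epsilon> by auto
  finally have "\<epsilon> *\<^sub>R (g *v w) = w" using n by simp
  then have "\<epsilon> *\<^sub>R (\<epsilon> *\<^sub>R (g *v w)) = \<epsilon> *\<^sub>R w" by simp
  then show ?thesis using \<epsilon>2 by simp
qed

text \<open>At the order \<open>n\<close> the recurrence reads 2 w = \<open>cheb t n\<close> w,
  which rules out a trace beyond 2 on the kernel; the borderline traces 2 and -2 are the scalar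
  case.\<close>

lemma finite_order_elliptic_or_scalar:
  "\<bar>trace g - 1\<bar> < 2 \<or> (\<exists>\<epsilon>\<in>{1, -1}. \<forall>w. \<phi> \<bullet> w = 0 \<longrightarrow> g *v w = \<epsilon> *\<^sub>R w)"
proof -
  define t where "t = trace g - 1"
  obtain w where w: "w \<noteq> 0" "orthogonal \<phi> w"
    using orthogonal_to_vector_exists[of \<phi>] by auto
  then have pw: "\<phi> \<bullet> w = 0" by (simp add: orthogonal_def)
  have CH: "g *v (g *v u) = t *\<^sub>R (g *v u) - u" if "\<phi> \<bullet> u = 0" for u
    using cayley_hamilton_fixed_covector[OF \<phi> fixed det that] by (simp add: t_def)
  have ker: "\<phi> \<bullet> (mpow g k *v w) = 0" for k
  proof (induction k)
    case (Suc k)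
    then show ?case
      by (simp add: fixed_covector_dot[OF fixed] flip: matrix_vector_mul_assoc)
  qed (simp add: pw)
  have "mpow g (0 + 2 * n) *v w + mpow g 0 *v w = cheb t n *\<^sub>R (mpow g (0 + n) *v w)"
    by (rule linear_recurrence_cheb) (simp add: CH ker flip: matrix_vector_mul_assoc)
  then have "2 *\<^sub>R w = cheb t n *\<^sub>R w"
    using ord by (simp add: mult.commute[of 2] mpow_mult scaleR_2)
  then have "cheb t n = 2" using w(1) by simp
  then have "\<not> \<bar>t\<bar> > 2" using abs_cheb_gt_2[of t n] n by auto
  then have "\<bar>t\<bar> < 2 \<or> t = 2 * 1 \<or> t = 2 * - 1" by linarith
  then show ?thesis
    using finite_order_scalar_on_kernel[of 1] finite_order_scalar_on_kernel[of "-1"]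
    unfolding t_def by auto
qed

end

text \<open>The determinant on the kernel is 1, so the second eigenvalue there is the inverse of
  \<open>\<epsilon>\<close>, which is \<open>\<epsilon>\<close> again.\<close>

lemma eigenvector_on_kernel_trace:
  fixes g :: "real^3^3"
  assumes "\<phi> \<noteq> 0" "\<phi> v* g = \<phi>" "det g = 1"
    and "\<phi> \<bullet> w = 0" "w \<noteq> 0" "g *v w = \<epsilon> *\<^sub>R w" "\<epsilon> \<in> {1, -1}"
  shows "trace g - 1 = 2 * \<epsilon>"
proof -
  have "w = ((trace g - 1) * \<epsilon>) *\<^sub>R w - w"
    using cayley_hamilton_fixed_covector[OF assms(1-4)] assms(6,7)
    by (auto simp: matrix_vector_mult_scaleR)
  then have "((trace g - 1) * \<epsilon>) *\<^sub>R w = 2 *\<^sub>R w"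
    by (simp only: eq_diff_eq scaleR_2)
  then have "(trace g - 1) * \<epsilon> = 2" using assms(5) by simp
  then show ?thesis using assms(7) by auto
qed

text \<open>Both \<open>h - mat 1\<close> and \<open>k - mat 1\<close> kill the kernel of
  \<open>\<phi>\<close> and map into it, so their products in either order vanish. In the chart
  where a nonzero \<open>\<phi>\<close> is 1 such matrices are translations.\<close>

lemma identity_on_kernel_commute:
  fixes h k :: "real^3^3"
  assumes "\<phi> v* h = \<phi>" "\<phi> v* k = \<phi>"
    and "\<And>w. \<phi> \<bullet> w = 0 \<Longrightarrow> h *v w = w" "\<And>w. \<phi> \<bullet> w = 0 \<Longrightarrow> k *v w = w"
  shows "h ** k = k ** h"
proof -
  have "h *v (k *v x) = k *v (h *v x)" for x
  proof -
    have "h *v (k *v x - x) = k *v x - x" "k *v (h *v x - x) = h *v x - x"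
      using assms by (simp_all add: inner_diff_right fixed_covector_dot)
    then have "h *v (k *v x) - h *v x = k *v x - x" "k *v (h *v x) - k *v x = h *v x - x"
      by (simp_all add: matrix_vector_mult_diff_distrib)
    then have "h *v (k *v x) = k *v x - x + h *v x" "k *v (h *v x) = h *v x - x + k *v x"
      by (simp_all only: diff_eq_eq)
    then show ?thesis by simp
  qed
  then show ?thesis by (simp add: matrix_eq flip: matrix_vector_mul_assoc)
qed

text \<open>The kernel of \<open>\<phi>\<close> is invariant under \<open>s\<close>, so the
  conjugate is the identity on it as well. A commutator that does not commute with a conjugate
  therefore cannot be trivial on this plane.\<close>

lemma conjugate_commutes_if_identity_on_kernel:
  fixes h s s' :: "real^3^3"
  assumes "\<phi> v* h = \<phi>" "\<phi> v* s = \<phi>" "s ** s' = mat 1"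
    and "\<And>w. \<phi> \<bullet> w = 0 \<Longrightarrow> h *v w = w"
  shows "h ** (s ** h ** s') = (s ** h ** s') ** h"
proof (rule identity_on_kernel_commute[OF assms(1)])
  have "(\<phi> v* s) v* s' = \<phi>" by (simp only: vector_matrix_mul_assoc assms(3) vector_matrix_mul_rid)
  then have s': "\<phi> v* s' = \<phi>" by (simp only: assms(2))
  show "\<phi> v* (s ** h ** s') = \<phi>"
    using assms(1,2) s' by (simp flip: vector_matrix_mul_assoc)
  fix w assume w: "\<phi> \<bullet> w = 0"
  show "h *v w = w" using assms(4) w by blast
  have "h *v (s' *v w) = s' *v w"
    by (rule assms(4)) (simp add: fixed_covector_dot[OF s'] w)
  then have "(s ** h ** s') *v w = s *v (s' *v w)"
    by (simp flip: matrix_vector_mul_assoc)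
  then show "(s ** h ** s') *v w = w"
    by (simp only: matrix_vector_mul_assoc assms(3) matrix_vector_mul_lid)
qed

lemma mult_eq_1_commute: "s ** s' = mat 1 \<Longrightarrow> s' ** s = mat 1" for s s' :: "real^'n^'n"
  using matrix_left_right_inverse by blast

locale convex_cone_action =
  fixes D :: "(real^3) set" and \<Gamma> :: "(real^3^3) set"
  assumes open_D: "open D" and convex_D: "convex D" and D_nonempty: "D \<noteq> {}"
    and cone_D: "\<lbrakk>x \<in> D; c > 0\<rbrakk> \<Longrightarrow> c *\<^sub>R x \<in> D"
    and salient_D: "x \<in> D \<Longrightarrow> - x \<notin> D"
    and det_1: "A \<in> \<Gamma> \<Longrightarrow> det A = 1"
    and inverse: "A \<in> \<Gamma> \<Longrightarrow> \<exists>B\<in>\<Gamma>. A ** B = mat 1"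
    and preserves: "\<lbrakk>A \<in> \<Gamma>; x \<in> D\<rbrakk> \<Longrightarrow> A *v x \<in> D \<or> - (A *v x) \<in> D"
begin

lemma nonzero: "x \<in> D \<Longrightarrow> x \<noteq> 0"
  using salient_D[of x] by auto

lemma add_D: "\<lbrakk>x \<in> D; y \<in> D\<rbrakk> \<Longrightarrow> x + y \<in> D"
proof -
  assume "x \<in> D" "y \<in> D"
  then have "(1/2) *\<^sub>R x + (1/2) *\<^sub>R y \<in> D" using convex_D by (simp add: convex_def)
  from cone_D[OF this, of 2] show ?thesis by (simp add: scaleR_add_right)
qed

lemma sum_D: "(\<And>j. z j \<in> D) \<Longrightarrow> (\<Sum>j<Suc k. z j) \<in> D"
  by (induction k) (auto intro: add_D)

lemma vanishing_on_D:
  assumes "\<And>x. x \<in> D \<Longrightarrow> \<eta> \<bullet> x = 0"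
  shows "\<eta> = 0"
proof -
  obtain x e where x: "x \<in> D" "e > 0" "ball x e \<subseteq> D"
    using D_nonempty open_D by (meson ex_in_conv openE)
  show ?thesis
  proof (rule ccontr)
    assume "\<eta> \<noteq> 0"
    define y where "y = x + (e / 2 / norm \<eta>) *\<^sub>R \<eta>"
    have "y \<in> ball x e" using \<open>\<eta> \<noteq> 0\<close> x(2) by (simp add: y_def dist_norm)
    then have "\<eta> \<bullet> y = 0" "\<eta> \<bullet> x = 0" using x assms by auto
    then show False using \<open>\<eta> \<noteq> 0\<close> x(2) by (simp add: y_def inner_add_right)
  qed
qed

text \<open>\<open>D\<close> and its negative are disjoint open sets, and the image of the connected
  set \<open>D\<close> lies in their union.\<close>

lemma uniform_sign:
  assumes A: "A \<in> \<Gamma>"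
  obtains \<epsilon> :: real where "\<epsilon> \<in> {1, -1}" "\<And>x. x \<in> D \<Longrightarrow> \<epsilon> *\<^sub>R (A *v x) \<in> D"
proof -
  have "connected ((*v) A ` D)"
    using convex_D by (intro connected_continuous_image convex_connected linear_continuous_on
        matrix_vector_mul_bounded_linear)
  moreover have "open (uminus ` D)" using open_D by (rule open_negations)
  moreover have "(*v) A ` D \<subseteq> D \<union> uminus ` D"
  proof
    fix y assume "y \<in> (*v) A ` D"
    then have "y \<in> D \<or> - y \<in> D" using preserves[OF A] by auto
    moreover have "y \<in> uminus ` D" if "- y \<in> D" using imageI[OF that, of uminus] by simp
    ultimately show "y \<in> D \<union> uminus ` D" by blast
  qed
  moreover have "D \<inter> uminus ` D \<inter> (*v) A ` D = {}" using salient_D by auto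
  ultimately have "D \<inter> (*v) A ` D = {} \<or> uminus ` D \<inter> (*v) A ` D = {}"
    using open_D connectedD by blast
  then show thesis
  proof
    assume "D \<inter> (*v) A ` D = {}"
    then have "(-1) *\<^sub>R (A *v x) \<in> D" if "x \<in> D" for x using preserves[OF A that] that by auto
    then show thesis using that[of "-1"] by blast
  next
    assume *: "uminus ` D \<inter> (*v) A ` D = {}"
    have "1 *\<^sub>R (A *v x) \<in> D" if "x \<in> D" for x
    proof (rule ccontr)
      assume "1 *\<^sub>R (A *v x) \<notin> D"
      then have "- (A *v x) \<in> D" using preserves[OF A that] by simp
      from imageI[OF this, of uminus] show False using that * by auto
    qed
    then show thesis using that[of 1] by blast
  qed
qed

text \<open>With the sign \<open>\<epsilon>\<close> of \<open>A\<close> on the cone, the orbit of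
  \<open>x\<close> under \<open>\<epsilon> A\<close> stays in \<open>D\<close>, and so does its sum,
  which is invariant. A fixed covector vanishing at \<open>x\<close> vanishes along the orbit. The
  sum has \<open>n * 2\<close> terms because \<open>\<epsilon> ^ n\<close> may be -1.\<close>

lemma finite_order_eigenvector:
  assumes A: "A \<in> \<Gamma>" and n: "n > 0" and ord: "mpow A n = mat 1" and x: "x \<in> D"
  obtains \<epsilon> y where "\<epsilon> \<in> {1, -1}" "y \<in> D" "A *v y = \<epsilon> *\<^sub>R y"
    "\<And>\<phi>. \<lbrakk>\<phi> v* A = \<phi>; \<phi> \<bullet> x = 0\<rbrakk> \<Longrightarrow> \<phi> \<bullet> y = 0"
proof -
  obtain \<epsilon> :: real where \<epsilon>: "\<epsilon> \<in> {1, -1}" and sgn: "\<And>x. x \<in> D \<Longrightarrow> \<epsilon> *\<^sub>R (A *v x) \<in> D"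
    using uniform_sign[OF A] by blast
  have \<epsilon>2: "\<epsilon> * \<epsilon> = 1" using \<epsilon> by auto
  define z where "z j = \<epsilon> ^ j *\<^sub>R (mpow A j *v x)" for j
  have z: "z 0 = x" "z (Suc j) = \<epsilon> *\<^sub>R (A *v z j)" for j
    by (simp_all add: z_def matrix_vector_mult_scaleR flip: matrix_vector_mul_assoc)
  have zD: "z j \<in> D" for j by (induction j) (simp_all add: z x sgn)
  have "mpow A (n * 2) = mat 1" "\<epsilon> ^ (n * 2) = 1"
    using ord \<epsilon> by (auto simp only: mpow_mult mpow_mat_1) auto
  then have z_per: "z (n * 2) = z 0" by (simp add: z_def)
  define y where "y = (\<Sum>j<n * 2. z j)"
  have "y \<in> D" using sum_D[of z "n * 2 - 1", OF zD] n by (simp add: y_def)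
  moreover have "A *v y = \<epsilon> *\<^sub>R y"
  proof -
    have "A *v z j = \<epsilon> *\<^sub>R z (Suc j)" for j by (simp add: z \<epsilon>2)
    then have "A *v y = \<epsilon> *\<^sub>R (\<Sum>j<n * 2. z (Suc j))"
      by (simp add: y_def scaleR_right.sum linear_sum[OF matrix_vector_mul_linear])
    also have "(\<Sum>j<n * 2. z (Suc j)) = y"
      using sum.lessThan_Suc_shift[of z "n * 2"] by (simp add: y_def z_per)
    finally show ?thesis .
  qed
  moreover have "\<phi> \<bullet> y = 0" if "\<phi> v* A = \<phi>" "\<phi> \<bullet> x = 0" for \<phi>
  proof -
    have "\<phi> \<bullet> z j = 0" for j
      by (induction j) (simp_all add: z that fixed_covector_dot)
    then show ?thesis by (simp add: y_def inner_sum_right)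
  qed
  ultimately show thesis using that \<epsilon> by blast
qed

text \<open>A hyperplane separating a point from a cone can be moved through the origin: scaling
  makes a negative value on \<open>D\<close> arbitrarily negative and a positive one arbitrarily
  small.\<close>

lemma separating_covector:
  assumes "p \<notin> D"
  obtains \<psi> where "\<psi> \<noteq> 0" "\<psi> \<bullet> p \<le> 0" "\<And>x. x \<in> D \<Longrightarrow> \<psi> \<bullet> x \<ge> 0"
proof -
  obtain \<psi> b where \<psi>: "\<psi> \<noteq> 0" "\<psi> \<bullet> p \<le> b" "\<And>x. x \<in> D \<Longrightarrow> \<psi> \<bullet> x \<ge> b"
    using separating_hyperplane_sets[of "{p}" D] convex_D D_nonempty assms by auto
  have "\<psi> \<bullet> x \<ge> 0" if "x \<in> D" for x
  proof (rule ccontr)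
    assume neg: "\<not> \<psi> \<bullet> x \<ge> 0"
    define c where "c = (\<bar>b\<bar> + 1) / - (\<psi> \<bullet> x)"
    have "c > 0" using neg by (simp add: c_def field_simps)
    then have "\<psi> \<bullet> (c *\<^sub>R x) \<ge> b" using \<psi>(3) cone_D that by blast
    moreover have "\<psi> \<bullet> (c *\<^sub>R x) = - (\<bar>b\<bar> + 1)" using neg by (simp add: c_def field_simps)
    ultimately show False by linarith
  qed
  moreover have "b \<le> 0"
  proof (rule ccontr)
    assume b: "\<not> b \<le> 0"
    obtain x where x: "x \<in> D" using D_nonempty by auto
    define c where "c = b / 2 / (\<psi> \<bullet> x)"
    have pos: "\<psi> \<bullet> x > 0" using \<psi>(3)[OF x] b by linarith
    then have "c > 0" using b by (simp add: c_def)
    then have "\<psi> \<bullet> (c *\<^sub>R x) \<ge> b" using \<psi>(3) cone_D x by blast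
    moreover have "\<psi> \<bullet> (c *\<^sub>R x) = b / 2" using pos by (simp add: c_def)
    ultimately show False using b by linarith
  qed
  ultimately show thesis using that[of \<psi>] \<psi> by fastforce
qed

text \<open>On the kernel of \<open>\<phi>\<close> the matrix \<open>(h + h\<^sup>-\<^sup>1) / 2\<close> is a scalar greater than 1, so \<open>D\<close> is invariant
  under an expansion away from the fixed point \<open>p\<close> of \<open>h\<close>. A covector separating \<open>p\<close> from \<open>D\<close> is
  therefore nonnegative on each \<open>a\<^sup>j w\<close>, and as these sum to 0 it vanishes on the kernel.\<close>

lemma hyperbolic_fixed_point:
  assumes \<phi>: "\<And>x. x \<in> D \<Longrightarrow> \<phi> \<bullet> x > 0"
    and a: "a \<in> \<Gamma>" "\<phi> v* a = \<phi>" "n > 0" "mpow a n = mat 1" "\<bar>trace a - 1\<bar> < 2"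
    and h: "h \<in> \<Gamma>" "\<phi> v* h = \<phi>" "trace h - 1 > 2"
  shows "\<exists>p\<in>D. h *v p = p"
proof -
  obtain x1 where x1: "x1 \<in> D" using D_nonempty by auto
  then have \<phi>0: "\<phi> \<noteq> 0" using \<phi>[of x1] by auto
  have pres: "A *v x \<in> D" if "A \<in> \<Gamma>" "\<phi> v* A = \<phi>" "x \<in> D" for A x
  proof (rule ccontr)
    assume "A *v x \<notin> D"
    then have "- (A *v x) \<in> D" using preserves that by blast
    then show False using \<phi>[of "- (A *v x)"] \<phi>[OF that(3)] that by (simp add: fixed_covector_dot)
  qed
  obtain h' where h': "h' \<in> \<Gamma>" "h ** h' = mat 1" using inverse[OF h(1)] by auto
  have "(\<phi> v* h) v* h' = \<phi>" by (simp only: vector_matrix_mul_assoc h'(2) vector_matrix_mul_rid)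
  then have \<phi>h': "\<phi> v* h' = \<phi>" by (simp only: h(2))
  have hh': "h *v (h' *v x) = x" for x
    by (simp only: matrix_vector_mul_assoc h'(2) matrix_vector_mul_lid)
  define \<tau> where "\<tau> = trace h - 1"
  have \<tau>: "\<tau> > 2" using h(3) by (simp add: \<tau>_def)
  have sum: "h *v w + h' *v w = \<tau> *\<^sub>R w" if "\<phi> \<bullet> w = 0" for w
    using cayley_hamilton_fixed_covector[OF \<phi>0 h(2) det_1[OF h(1)], of "h' *v w"] that
    by (simp add: fixed_covector_dot[OF \<phi>h'] hh' \<tau>_def algebra_simps)
  define x0 where "x0 = (1 / (\<phi> \<bullet> x1)) *\<^sub>R x1"
  have x0: "x0 \<in> D" "\<phi> \<bullet> x0 = 1" using \<phi>[OF x1] cone_D[OF x1] by (simp_all add: x0_def)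
  define w0 where "w0 = h *v x0 - x0"
  have w0: "\<phi> \<bullet> w0 = 0" by (simp add: w0_def inner_diff_right fixed_covector_dot[OF h(2)])
  \<comment> \<open>On the kernel, (h - 1) (h' - 1) is multiplication by \<open>2 - \<tau>\<close>;
    dividing by this number cancels the displacement \<open>w0\<close> of \<open>x0\<close>.\<close>
  define p where "p = x0 + (1 / (\<tau> - 2)) *\<^sub>R (h' *v w0 - w0)"
  have \<phi>p: "\<phi> \<bullet> p = 1"
    by (simp add: p_def inner_add_right inner_diff_right x0 w0 fixed_covector_dot[OF \<phi>h'])
  have hp: "h *v p = p"
  proof -
    have "h *v p - p = w0 + (1 / (\<tau> - 2)) *\<^sub>R (w0 - h *v w0) - (1 / (\<tau> - 2)) *\<^sub>R (h' *v w0 - w0)"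
      by (simp add: p_def matrix_vector_right_distrib matrix_vector_mult_scaleR
          matrix_vector_mult_diff_distrib hh' w0_def)
    also have "\<dots> = w0 + (1 / (\<tau> - 2)) *\<^sub>R (2 *\<^sub>R w0 - (h *v w0 + h' *v w0))"
      by (simp add: scaleR_2 algebra_simps)
    also have "2 *\<^sub>R w0 - (h *v w0 + h' *v w0) = (- (\<tau> - 2)) *\<^sub>R w0"
      by (simp only: sum[OF w0]) (simp add: algebra_simps)
    also have "w0 + (1 / (\<tau> - 2)) *\<^sub>R ((- (\<tau> - 2)) *\<^sub>R w0) = 0"
    proof -
      have "(1 / (\<tau> - 2)) * (- (\<tau> - 2)) = -1" using \<tau> by (simp add: field_simps)
      then show ?thesis by (simp only: scaleR_scaleR) simp
    qed
    finally show ?thesis by simp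
  qed
  have h'p: "h' *v p = p"
    using h'(2) hp by (metis matrix_vector_mul_assoc matrix_vector_mul_lid mult_eq_1_commute)
  \<comment> \<open>Averaging the images under \<open>h\<close> and \<open>h'\<close> keeps the
    component along \<open>p\<close> and multiplies the rest by \<open>\<tau> / 2\<close>, which
    exceeds 1.\<close>
  have expand: "(\<phi> \<bullet> x) *\<^sub>R p + (\<tau> / 2) ^ k *\<^sub>R (x - (\<phi> \<bullet> x) *\<^sub>R p) \<in> D" if x: "x \<in> D" for x k
  proof (induction k)
    case 0
    show ?case using x by simp
  next
    case (Suc k)
    define w where "w = (\<tau> / 2) ^ k *\<^sub>R (x - (\<phi> \<bullet> x) *\<^sub>R p)"
    define y where "y = (\<phi> \<bullet> x) *\<^sub>R p + w"
    have w: "\<phi> \<bullet> w = 0" by (simp add: w_def inner_diff_right \<phi>p)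
    have "y \<in> D" using Suc by (simp add: y_def w_def)
    then have "h *v y + h' *v y \<in> D" using pres h h' \<phi>h' add_D by blast
    then have "(1 / 2) *\<^sub>R (h *v y + h' *v y) \<in> D" using cone_D by simp
    also have "h *v y + h' *v y = (\<phi> \<bullet> x) *\<^sub>R p + (\<phi> \<bullet> x) *\<^sub>R p + (h *v w + h' *v w)"
      by (simp add: y_def matrix_vector_right_distrib matrix_vector_mult_scaleR hp h'p)
    also have "(1 / 2) *\<^sub>R \<dots> = (\<phi> \<bullet> x) *\<^sub>R p + (\<tau> / 2) *\<^sub>R w"
      unfolding sum[OF w] by (simp add: scaleR_right_distrib flip: scaleR_left_distrib)
    finally show ?case by (simp add: w_def)
  qed
  have "p \<in> D"
  proof (rule ccontr)
    assume "p \<notin> D"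
    then obtain \<psi> where \<psi>: "\<psi> \<noteq> 0" "\<psi> \<bullet> p \<le> 0" "\<And>x. x \<in> D \<Longrightarrow> \<psi> \<bullet> x \<ge> 0"
      using separating_covector by blast
    have "\<psi> \<bullet> (x - (\<phi> \<bullet> x) *\<^sub>R p) = 0" if x: "x \<in> D" for x
    proof -
      define w where "w = x - (\<phi> \<bullet> x) *\<^sub>R p"
      have w: "\<phi> \<bullet> w = 0" by (simp add: w_def inner_diff_right \<phi>p)
      have a_pres: "mpow a j *v y \<in> D" if "y \<in> D" for j y
        using that pres[OF a(1,2)] by (induction j) (simp_all flip: matrix_vector_mul_assoc)
      have nonneg: "\<psi> \<bullet> (mpow a j *v w) \<ge> 0" for j
      proof (rule ccontr)
        define \<alpha> \<beta> where "\<alpha> = \<psi> \<bullet> (mpow a j *v w)" and "\<beta> = (\<phi> \<bullet> x) * (\<psi> \<bullet> (mpow a j *v p))"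
        assume "\<not> \<psi> \<bullet> (mpow a j *v w) \<ge> 0"
        then have \<alpha>: "\<alpha> < 0" by (simp add: \<alpha>_def)
        \<comment> \<open>The factor of \<open>\<alpha>\<close> is unbounded in \<open>k\<close>, so
          a negative \<open>\<alpha>\<close> would eventually outweigh
          \<open>\<beta>\<close>.\<close>
        have le: "0 \<le> \<beta> + (\<tau> / 2) ^ k * \<alpha>" for k
          using \<psi>(3)[OF a_pres[OF expand[OF x, of k]], of j, folded w_def]
          by (simp add: matrix_vector_right_distrib matrix_vector_mult_scaleR inner_add_right \<alpha>_def \<beta>_def)
        obtain k where "(\<tau> / 2) ^ k > \<beta> / - \<alpha>"
          using real_arch_pow[of "\<tau> / 2"] \<tau> by auto
        then have "(\<tau> / 2) ^ k * - \<alpha> > \<beta>" using \<alpha> by (simp only: pos_divide_less_eq neg_0_less_iff_less)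
        then show False using le[of k] by simp
      qed
      define S where "S = (\<Sum>j<n. mpow a j *v w)"
      \<comment> \<open>A nonzero orbit sum would be a fixed vector of \<open>a\<close> in the
        kernel and force the trace 2 there, but \<open>a\<close> is elliptic.\<close>
      have "S = 0"
      proof (rule ccontr)
        assume "S \<noteq> 0"
        have "a *v S = (\<Sum>j<n. mpow a (Suc j) *v w)"
          by (simp add: S_def linear_sum[OF matrix_vector_mul_linear] matrix_vector_mul_assoc)
        also have "\<dots> = S"
          using sum.lessThan_Suc_shift[of "\<lambda>j. mpow a j *v w" n] a(4) by (simp add: S_def)
        finally have "a *v S = 1 *\<^sub>R S" by simp
        moreover have "\<phi> \<bullet> (mpow a j *v w) = 0" for j
          by (induction j) (simp_all add: w fixed_covector_dot[OF a(2)] flip: matrix_vector_mul_assoc)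
        then have "\<phi> \<bullet> S = 0" by (simp add: S_def inner_sum_right)
        ultimately have "trace a - 1 = 2 * 1"
          using eigenvector_on_kernel_trace[OF \<phi>0 a(2) det_1[OF a(1)]] \<open>S \<noteq> 0\<close> by blast
        then show False using a(5) by simp
      qed
      then have "(\<Sum>j<n. \<psi> \<bullet> (mpow a j *v w)) = 0" by (simp add: S_def flip: inner_sum_right)
      then have "\<forall>j\<in>{..<n}. \<psi> \<bullet> (mpow a j *v w) = 0"
        using nonneg by (subst (asm) sum_nonneg_eq_0_iff) auto
      from bspec[OF this, of 0] show ?thesis using a(3) by (simp add: w_def)
    qed
    \<comment> \<open>So \<open>\<psi>\<close> is a multiple of \<open>\<phi>\<close>, with factor
      \<open>\<psi> \<bullet> p\<close>. The separation makes the factor at most 0, and evaluation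
      at \<open>x0\<close> makes it at least 0.\<close>
    then have eq: "\<psi> \<bullet> x = (\<phi> \<bullet> x) * (\<psi> \<bullet> p)" if "x \<in> D" for x
      using that by (simp add: inner_diff_right)
    then have "\<psi> - (\<psi> \<bullet> p) *\<^sub>R \<phi> = 0"
      by (intro vanishing_on_D) (simp add: inner_diff_left)
    moreover have "\<psi> \<bullet> p = 0" using eq[OF x0(1)] \<psi>(3)[OF x0(1)] \<psi>(2) x0(2) by simp
    ultimately show False using \<psi>(1) by simp
  qed
  then show ?thesis using hp by blast
qed

section \<open>Two elements of finite order and their commutator\<close>

context
  fixes a b h :: "real^3^3" and m n :: nat
  assumes a: "a \<in> \<Gamma>" "m > 0" "mpow a m = mat 1"
    and b: "b \<in> \<Gamma>" "n > 0" "mpow b n = mat 1"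
    and h: "h \<in> \<Gamma>" "h ** b ** a = a ** b"
    and no_fixed: "\<And>x. x \<in> D \<Longrightarrow> h *v x \<noteq> x"
    and nc: "\<exists>s\<in>{a, b}. \<exists>s'. s ** s' = mat 1 \<and> h ** (s ** h ** s') \<noteq> (s ** h ** s') ** h"
begin

lemma h_apply: "h *v (b *v (a *v x)) = a *v (b *v x)"
  using h(2) by (metis matrix_vector_mul_assoc)

text \<open>Since \<open>h\<close> fixes \<open>v\<close>, neither \<open>v\<close> nor its negative
  lies in \<open>D\<close>. Hence the eigenvector in \<open>D\<close> of each generator is
  independent of \<open>v\<close> and yields an eigenvalue 1 or -1 on the quotient by
  \<open>v\<close>. Determinant 1 and finite order make the generator this scalar on the covectors
  killing \<open>v\<close>, so \<open>h\<close> is trivial on them.\<close>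

lemma no_common_fixed_vector:
  assumes v: "a *v v = v" "b *v v = v"
  shows "v = 0"
proof (rule ccontr)
  assume v0: "v \<noteq> 0"
  have hv: "h *v v = v" using h_apply[of v] v by simp
  then have vD: "v \<notin> D" "- v \<notin> D"
    using no_fixed[of v] no_fixed[of "- v"] linear_neg[OF matrix_vector_mul_linear, of h v] by auto
  have scalar: "\<exists>\<epsilon>\<in>{1, -1}. \<forall>\<psi>. v \<bullet> \<psi> = 0 \<longrightarrow> \<psi> v* s = \<epsilon> *\<^sub>R \<psi>"
    if s: "s \<in> \<Gamma>" "k > 0" "mpow s k = mat 1" "s *v v = v" for s k
  proof -
    obtain x where x: "x \<in> D" using D_nonempty by auto
    obtain \<epsilon> y where \<epsilon>: "\<epsilon> \<in> {1, -1}" and y: "y \<in> D" "s *v y = \<epsilon> *\<^sub>R y"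
      using finite_order_eigenvector[OF s(1-3) x] by metis
    \<comment> \<open>Transposition turns the fixed vector into a fixed covector, so the results on
      kernels apply to the covectors killing \<open>v\<close>.\<close>
    define g where "g = transpose s"
    have g: "v v* g = v" "det g = 1" "mpow g k = mat 1"
      using s by (simp_all add: g_def det_1 transpose_mat flip: transpose_mpow)
    \<comment> \<open>The part of \<open>y\<close> orthogonal to \<open>v\<close>, used as a
      covector that kills \<open>v\<close> but not \<open>y\<close>. Pairing Cayley-Hamilton for
      \<open>\<psi>\<close> with the eigenvector \<open>y\<close> leaves an equation for the trace
      alone.\<close>
    define \<psi> where "\<psi> = y - ((v \<bullet> y) / (v \<bullet> v)) *\<^sub>R v"
    have \<psi>v: "v \<bullet> \<psi> = 0" using v0 by (simp add: \<psi>_def inner_diff_right)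
    have "\<psi> \<noteq> 0"
    proof
      assume "\<psi> = 0"
      then obtain c where c: "y = c *\<^sub>R v" by (auto simp: \<psi>_def)
      then have "c \<noteq> 0" using nonzero[OF y(1)] by auto
      then consider "c > 0" | "c < 0" by linarith
      then show False
      proof cases
        case 1
        then have "v = (1 / c) *\<^sub>R y" using c by simp
        then show False using cone_D[OF y(1)] 1 vD(1) by simp
      next
        case 2
        then have "- v = (1 / - c) *\<^sub>R y" using c by simp
        then show False using cone_D[OF y(1), of "1 / - c"] 2 vD(2) by simp
      qed
    qed
    moreover have "\<psi> \<bullet> y = \<psi> \<bullet> \<psi> + ((v \<bullet> y) / (v \<bullet> v)) * (v \<bullet> \<psi>)"
      by (simp add: \<psi>_def inner_diff_left inner_diff_right inner_commute algebra_simps)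
    ultimately have \<psi>y: "\<psi> \<bullet> y \<noteq> 0" using \<psi>v by simp
    have "g *v (g *v \<psi>) = (trace g - 1) *\<^sub>R (g *v \<psi>) - \<psi>"
      by (rule cayley_hamilton_fixed_covector[OF v0 g(1,2) \<psi>v])
    then have "(\<psi> v* s v* s) \<bullet> y = ((trace g - 1) *\<^sub>R (\<psi> v* s) - \<psi>) \<bullet> y"
      by (simp add: g_def)
    moreover have "(\<psi> v* s) \<bullet> y = \<epsilon> * (\<psi> \<bullet> y)" by (simp add: dot_lmul_matrix y(2))
    moreover have "(\<psi> v* s v* s) \<bullet> y = \<psi> \<bullet> y"
      using \<epsilon> by (auto simp: dot_lmul_matrix y(2) matrix_vector_mult_scaleR linear_neg[OF matrix_vector_mul_linear])
    ultimately have "\<psi> \<bullet> y = (trace g - 1) * \<epsilon> * (\<psi> \<bullet> y) - \<psi> \<bullet> y"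
      by (simp only: inner_diff_left inner_scaleR_left mult.assoc)
    then have "(2 - (trace g - 1) * \<epsilon>) * (\<psi> \<bullet> y) = 0" by (simp add: algebra_simps)
    then have "(trace g - 1) * \<epsilon> = 2" using \<psi>y by simp
    then have "trace g - 1 = 2 * \<epsilon>" using \<epsilon> by auto
    from finite_order_scalar_on_kernel[OF v0 g(1,2) s(2) g(3) this \<epsilon>]
    show ?thesis using \<epsilon> by (auto simp: g_def)
  qed
  obtain \<alpha> where \<alpha>: "\<alpha> \<in> {1, -1}" "\<And>\<psi>. v \<bullet> \<psi> = 0 \<Longrightarrow> \<psi> v* a = \<alpha> *\<^sub>R \<psi>"
    using scalar[OF a v(1)] by blast
  obtain \<beta> where \<beta>: "\<beta> \<in> {1, -1}" "\<And>\<psi>. v \<bullet> \<psi> = 0 \<Longrightarrow> \<psi> v* b = \<beta> *\<^sub>R \<psi>"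
    using scalar[OF b v(2)] by blast
  have h_id: "\<psi> v* h = \<psi>" if \<psi>: "v \<bullet> \<psi> = 0" for \<psi>
  proof -
    have \<psi>h: "v \<bullet> (\<psi> v* h) = 0"
      using hv \<psi> by (simp add: inner_commute[of v] dot_lmul_matrix)
    have "\<psi> v* h v* b v* a = \<psi> v* a v* b"
      using h(2) by (simp add: vector_matrix_mul_assoc matrix_mul_assoc)
    then have "(\<alpha> * \<beta>) *\<^sub>R (\<psi> v* h) = (\<alpha> * \<beta>) *\<^sub>R \<psi>"
      using \<psi> \<psi>h by (simp add: \<alpha>(2) \<beta>(2) scaleR_vector_matrix_assoc mult.commute)
    then show ?thesis using \<alpha>(1) \<beta>(1) by auto
  qed
  obtain s s' where s: "s \<in> {a, b}" "s ** s' = mat 1" and neq: "h ** (s ** h ** s') \<noteq> (s ** h ** s') ** h"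
    using nc by blast
  have s's: "s' ** s = mat 1" by (rule mult_eq_1_commute[OF s(2)])
  have sv: "s *v v = v" using s(1) v by auto
  have s'v: "s' *v v = v" using sv s's by (metis matrix_vector_mul_assoc matrix_vector_mul_lid)
  \<comment> \<open>Transposition reverses products, so \<open>transpose s'\<close> takes the place
    of the conjugating matrix.\<close>
  have "transpose h ** (transpose s' ** transpose h ** transpose s) =
      (transpose s' ** transpose h ** transpose s) ** transpose h"
    by (rule conjugate_commutes_if_identity_on_kernel[of v])
      (simp_all add: hv s'v h_id transpose_mat s(2) flip: matrix_transpose_mul)
  then have "transpose ((s ** h ** s') ** h) = transpose (h ** (s ** h ** s'))"
    by (simp add: matrix_transpose_mul matrix_mul_assoc)
  then show False using neq by (metis transpose_transpose)
qed

text \<open>If the generators commute on the kernel of \<open>\<phi>\<close>, then \<open>h\<close>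
  is the identity there, which \<open>nc\<close> forbids and which would also fix any point of
  \<open>D\<close> in the kernel. What remains is \<open>a\<close> elliptic and \<open>h\<close>
  hyperbolic on the kernel, and \<open>\<phi>\<close> without zero on \<open>D\<close>: the
  situation of \<open>hyperbolic_fixed_point\<close>.\<close>

lemma no_common_fixed_covector:
  assumes \<phi>: "\<phi> v* a = \<phi>" "\<phi> v* b = \<phi>"
  shows "\<phi> = 0"
proof (rule ccontr)
  assume \<phi>0: "\<phi> \<noteq> 0"
  obtain a' b' where a': "a ** a' = mat 1" and b': "b ** b' = mat 1"
    using inverse a(1) b(1) by meson
  have \<phi>a': "\<phi> v* a' = \<phi>"
    by (metis \<phi>(1) a' vector_matrix_mul_assoc vector_matrix_mul_rid)
  have \<phi>b': "\<phi> v* b' = \<phi>"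
    by (metis \<phi>(2) b' vector_matrix_mul_assoc vector_matrix_mul_rid)
  have ba: "b *v (a *v (a' *v (b' *v x))) = x" for x
    by (metis a' b' matrix_vector_mul_assoc matrix_vector_mul_lid)
  have hx: "h *v x = a *v (b *v (a' *v (b' *v x)))" for x
    using h_apply[of "a' *v (b' *v x)"] by (simp only: ba)
  have \<phi>h: "\<phi> v* h = \<phi>"
  proof -
    have "(\<phi> v* h) \<bullet> x = \<phi> \<bullet> x" for x
      by (simp add: dot_lmul_matrix hx fixed_covector_dot \<phi> \<phi>a' \<phi>b')
    then show ?thesis by (metis vector_eq_rdot)
  qed
  have h_id: "h *v w = w"
    if comm: "\<And>w. \<phi> \<bullet> w = 0 \<Longrightarrow> a *v (b *v w) = b *v (a *v w)" and w: "\<phi> \<bullet> w = 0" for w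
    using comm[of "a' *v (b' *v w)"] w by (simp add: hx ba fixed_covector_dot \<phi>a' \<phi>b')
  have not_id: "\<exists>w. \<phi> \<bullet> w = 0 \<and> h *v w \<noteq> w"
  proof (rule ccontr)
    assume *: "\<nexists>w. \<phi> \<bullet> w = 0 \<and> h *v w \<noteq> w"
    obtain s s' where "s \<in> {a, b}" "s ** s' = mat 1" "h ** (s ** h ** s') \<noteq> (s ** h ** s') ** h"
      using nc by blast
    moreover from this(1) have "\<phi> v* s = \<phi>" using \<phi> by auto
    ultimately show False using conjugate_commutes_if_identity_on_kernel[OF \<phi>h] * by blast
  qed
  show False
  proof (cases "\<exists>x\<in>D. \<phi> \<bullet> x = 0")
    case True
    then obtain x where x: "x \<in> D" "\<phi> \<bullet> x = 0" by blast
    have scalar: "\<exists>\<epsilon>. \<forall>w. \<phi> \<bullet> w = 0 \<longrightarrow> s *v w = \<epsilon> *\<^sub>R w"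
      if s: "s \<in> \<Gamma>" "k > 0" "mpow s k = mat 1" "\<phi> v* s = \<phi>" for s k
    proof -
      \<comment> \<open>The last clause of \<open>finite_order_eigenvector\<close> places the
        eigenvector in the kernel of \<open>\<phi>\<close>.\<close>
      obtain \<epsilon> y where \<epsilon>: "\<epsilon> \<in> {1, -1}" and y: "y \<in> D" "s *v y = \<epsilon> *\<^sub>R y" "\<phi> \<bullet> y = 0"
        using finite_order_eigenvector[OF s(1-3) x(1)] x(2) s(4) by metis
      have "trace s - 1 = 2 * \<epsilon>"
        by (rule eigenvector_on_kernel_trace[OF \<phi>0 s(4) det_1[OF s(1)] y(3) nonzero[OF y(1)] y(2) \<epsilon>])
      from finite_order_scalar_on_kernel[OF \<phi>0 s(4) det_1[OF s(1)] s(2,3) this \<epsilon>]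
      show ?thesis by blast
    qed
    obtain \<alpha> where \<alpha>: "\<And>w. \<phi> \<bullet> w = 0 \<Longrightarrow> a *v w = \<alpha> *\<^sub>R w" using scalar[OF a \<phi>(1)] by blast
    obtain \<beta> where \<beta>: "\<And>w. \<phi> \<bullet> w = 0 \<Longrightarrow> b *v w = \<beta> *\<^sub>R w" using scalar[OF b \<phi>(2)] by blast
    have "h *v w = w" if "\<phi> \<bullet> w = 0" for w
      by (rule h_id[OF _ that]) (simp add: \<alpha> \<beta> mult.commute)
    then show False using no_fixed x by blast
  next
    case False
    obtain w where w: "\<phi> \<bullet> w = 0" "h *v w \<noteq> w" using not_id by blast
    have ell: "\<bar>trace a - 1\<bar> < 2"
    proof (rule ccontr)
      assume "\<not> \<bar>trace a - 1\<bar> < 2"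
      then obtain \<alpha> where \<alpha>: "\<And>w. \<phi> \<bullet> w = 0 \<Longrightarrow> a *v w = \<alpha> *\<^sub>R w"
        using finite_order_elliptic_or_scalar[OF \<phi>0 \<phi>(1) det_1[OF a(1)] a(2,3)] by blast
      have "h *v w = w"
        by (rule h_id[OF _ w(1)]) (simp add: \<alpha> fixed_covector_dot[OF \<phi>(2)] matrix_vector_mult_scaleR)
      then show False using w(2) by blast
    qed
    have hyp: "trace h - 1 > 2"
    proof (rule ccontr)
      assume "\<not> trace h - 1 > 2"
      then have "a *v (b *v w) = b *v (a *v w)" if "\<phi> \<bullet> w = 0" for w
        using elliptic_commutator_fixed_covector[OF \<phi>0 \<phi> \<phi>h det_1[OF a(1)] det_1[OF b(1)] h(2) ell _ that]
        by simp
      then show False using h_id w by blast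
    qed
    have sgn: "(\<forall>x\<in>D. \<phi> \<bullet> x > 0) \<or> (\<forall>x\<in>D. - \<phi> \<bullet> x > 0)"
    proof (rule ccontr)
      assume "\<not> ((\<forall>x\<in>D. \<phi> \<bullet> x > 0) \<or> (\<forall>x\<in>D. - \<phi> \<bullet> x > 0))"
      then obtain x y where "x \<in> D" "y \<in> D" "\<phi> \<bullet> x \<le> 0" "0 \<le> \<phi> \<bullet> y"
        by (auto simp: not_less)
      then show False
        using connected_ivt_hyperplane[OF convex_connected[OF convex_D], of x y \<phi> 0] False by blast
    qed
    have neg: "- \<phi> v* s = - \<phi>" if "\<phi> v* s = \<phi>" for s
      using that scaleR_vector_matrix_assoc[of "-1" \<phi> s] by simp
    have "\<exists>p\<in>D. h *v p = p"
      using sgn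
    proof
      assume "\<forall>x\<in>D. \<phi> \<bullet> x > 0"
      then show ?thesis using hyperbolic_fixed_point[of \<phi> a m h] a h ell hyp \<phi> \<phi>h by blast
    next
      assume "\<forall>x\<in>D. - \<phi> \<bullet> x > 0"
      then show ?thesis
        using hyperbolic_fixed_point[of "- \<phi>" a m h] a h ell hyp neg[OF \<phi>(1)] neg[OF \<phi>h] by blast
    qed
    then show False using no_fixed by blast
  qed
qed

end

end

section \<open>Deformations of representations fixing no vector and no covector\<close>

lemma det_4:
  "det (A::'a::comm_ring_1^4^4) =
    A$1$1 * (A$2$2 * (A$3$3 * A$4$4 - A$3$4 * A$4$3) - A$2$3 * (A$3$2 * A$4$4 - A$3$4 * A$4$2) + A$2$4 * (A$3$2 * A$4$3 - A$3$3 * A$4$2))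
  - A$1$2 * (A$2$1 * (A$3$3 * A$4$4 - A$3$4 * A$4$3) - A$2$3 * (A$3$1 * A$4$4 - A$3$4 * A$4$1) + A$2$4 * (A$3$1 * A$4$3 - A$3$3 * A$4$1))
  + A$1$3 * (A$2$1 * (A$3$2 * A$4$4 - A$3$4 * A$4$2) - A$2$2 * (A$3$1 * A$4$4 - A$3$4 * A$4$1) + A$2$4 * (A$3$1 * A$4$2 - A$3$2 * A$4$1))
  - A$1$4 * (A$2$1 * (A$3$2 * A$4$3 - A$3$3 * A$4$2) - A$2$2 * (A$3$1 * A$4$3 - A$3$3 * A$4$1) + A$2$3 * (A$3$1 * A$4$2 - A$3$2 * A$4$1))"
proof -
  have f1234: "finite {2::4, 3, 4}" "1 \<notin> {2::4, 3, 4}" by auto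
  have f234: "finite {3::4, 4}" "2 \<notin> {3::4, 4}" by auto
  have f34: "finite {4::4}" "3 \<notin> {4::4}" by auto
  show ?thesis
    unfolding det_def UNIV_4
    unfolding sum_over_permutations_insert[OF f1234]
    unfolding sum_over_permutations_insert[OF f234]
    unfolding sum_over_permutations_insert[OF f34]
    unfolding permutes_sing
    by (simp add: sign_swap_id permutation_swap_id sign_compose permutation_compose sign_id swap_id_eq)
       (simp add: algebra_simps)
qed

lemma matrix_add_rdistrib: "(A + B) ** C = A ** C + B ** C" for A B :: "'a::comm_ring_1^'n^'m"
  by (simp add: vec_eq_iff matrix_matrix_mult_def sum.distrib distrib_right)

lemma matrix_diff_distrib:
  fixes C :: "'a::comm_ring_1^'n^'n"
  shows "(A - B) ** C = A ** C - B ** C" "C ** (A - B) = C ** A - C ** B"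
  by (simp_all add: vec_eq_iff matrix_matrix_mult_def sum_subtractf left_diff_distrib right_diff_distrib)

lemma dim_image_kernel:
  fixes f :: "'a::euclidean_space \<Rightarrow> 'b::euclidean_space"
  assumes f: "linear f" and S: "subspace S"
  shows "dim (f ` S) + dim (S \<inter> {x. f x = 0}) = dim S"
proof -
  define K where "K = S \<inter> {x. f x = 0}"
  have K: "subspace K" using S unfolding K_def subspace_def
    by (auto simp: linear_0[OF f] linear_add[OF f] linear_cmul[OF f])
  define S' where "S' = {y \<in> S. \<forall>x\<in>K. orthogonal x y}"
  have dim: "dim S' + dim K = dim S"
    unfolding S'_def by (rule dim_subspace_orthogonal_to_vectors[OF K S]) (auto simp: K_def)
  have S': "subspace S'"
    using S unfolding S'_def subspace_def by (auto simp: orthogonal_def inner_add_right)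
  have img: "f ` S = f ` S'"
  proof
    show "f ` S \<subseteq> f ` S'"
    proof
      fix y assume "y \<in> f ` S"
      then obtain x where x: "x \<in> S" "y = f x" by auto
      obtain u z where u: "u \<in> span K" "\<And>w. w \<in> span K \<Longrightarrow> orthogonal z w" "x = u + z"
        by (rule orthogonal_subspace_decomp_exists[of K x]) (rule that)
      have uK: "u \<in> K" using u(1) K span_eq_iff by blast
      then have "z \<in> S" using x(1) u(3) S unfolding K_def
        by (metis Int_iff add_diff_cancel_left' subspace_diff)
      then have "z \<in> S'" using u(2) by (auto simp: S'_def orthogonal_commute span_base)
      moreover have "f x = f z" using uK u(3) by (simp add: K_def linear_add[OF f])
      ultimately show "y \<in> f ` S'" using x by auto
    qed
  qed (auto simp: S'_def)
  have span_S': "span S' = S'" using S' span_eq_iff by blast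
  have "inj_on f S'"
  proof (subst linear_injective_on_subspace_0[OF f S'], intro ballI impI)
    fix x assume "x \<in> S'" "f x = 0"
    then have "orthogonal x x" by (auto simp: S'_def K_def)
    then show "x = 0" by (simp add: orthogonal_self)
  qed
  then have "dim (f ` S') = dim S'"
    by (intro eucl.dim_image_eq f) (simp only: span_S')
  then show ?thesis using dim img by (simp add: K_def)
qed

section \<open>Dimensions of fixed spaces\<close>

definition fixed_space :: "real^'n^'n \<Rightarrow> (real^'n) set" where
  "fixed_space A = {x. A *v x = x}"

lemma subspace_fixed_space: "subspace (fixed_space A)"
  by (auto simp: fixed_space_def subspace_def matrix_vector_right_distrib matrix_vector_mult_scaleR)

text \<open>The map \<open>x \<mapsto> B x - x\<close> sends the fixed space of \<open>A B\<close> into the intersection of the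
  images of \<open>A - 1\<close> and \<open>B - 1\<close>, and its kernel there is the common fixed space.\<close>

lemma dim_fixed_spaces_le:
  fixes A B :: "real^'n^'n"
  shows "dim (fixed_space A) + dim (fixed_space B) + dim (fixed_space (A ** B))
    \<le> CARD('n) + dim (fixed_space A \<inter> fixed_space B)
       + dim (fixed_space (transpose A) \<inter> fixed_space (transpose B))"
proof -
  define f where "f M x = M *v x - x" for M :: "real^'n^'n" and x
  have lin: "linear (f M)" for M
    unfolding f_def by (intro linear_compose_sub matrix_vector_mul_linear linear_ident)
  define I where "I M = range (f M)" for M
  have sub: "subspace (I M)" for M
    unfolding I_def using lin by (intro linear_subspace_image subspace_UNIV)
  have dimI: "dim (I M) + dim (fixed_space M) = CARD('n)" for M
    using dim_image_kernel[OF lin subspace_UNIV, of M] by (simp add: I_def f_def fixed_space_def)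
  define W where "W = {x + y | x y. x \<in> I A \<and> y \<in> I B}"
  have W: "subspace W" unfolding W_def by (rule subspace_sums[OF sub sub])
  have dimW: "dim W + dim (I A \<inter> I B) = dim (I A) + dim (I B)"
    unfolding W_def by (rule dim_sums_Int[OF sub sub])
  have mem_fix: "\<phi> \<in> fixed_space (transpose M) \<longleftrightarrow> (\<forall>x\<in>I M. x \<bullet> \<phi> = 0)" for M \<phi>
  proof -
    have "(\<forall>x\<in>I M. x \<bullet> \<phi> = 0) \<longleftrightarrow> (\<forall>x. (\<phi> v* M) \<bullet> x = \<phi> \<bullet> x)"
      by (auto simp: I_def f_def inner_diff_left dot_lmul_matrix inner_commute[of _ \<phi>] inner_diff_right)
    also have "\<dots> \<longleftrightarrow> \<phi> v* M = \<phi>" by (metis vector_eq_rdot)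
    finally show ?thesis by (simp add: fixed_space_def)
  qed
  \<comment> \<open>A fixed covector is one that kills all displacements, so the common ones form
    the annihilator of the sum \<open>W\<close> of both images. This is how the dual fixed space
    enters the count.\<close>
  have "{y \<in> UNIV. \<forall>x\<in>W. orthogonal x y} = fixed_space (transpose A) \<inter> fixed_space (transpose B)"
  proof (intro Set.set_eqI iffI)
    fix y assume "y \<in> {y \<in> UNIV. \<forall>x\<in>W. orthogonal x y}"
    moreover have "I A \<subseteq> W" "I B \<subseteq> W"
      using subspace_0[OF sub] unfolding W_def by (force intro: exI[of _ 0])+
    ultimately show "y \<in> fixed_space (transpose A) \<inter> fixed_space (transpose B)"
      by (auto simp: mem_fix orthogonal_def)
  next
    fix y assume "y \<in> fixed_space (transpose A) \<inter> fixed_space (transpose B)"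
    then show "y \<in> {y \<in> UNIV. \<forall>x\<in>W. orthogonal x y}"
      by (auto simp: mem_fix orthogonal_def W_def inner_add_left)
  qed
  then have dimFT: "dim (fixed_space (transpose A) \<inter> fixed_space (transpose B)) + dim W = CARD('n)"
    using dim_subspace_orthogonal_to_vectors[OF W subspace_UNIV] by simp
  have "f B ` fixed_space (A ** B) \<subseteq> I A \<inter> I B"
  proof
    fix y assume "y \<in> f B ` fixed_space (A ** B)"
    then obtain x where x: "A *v (B *v x) = x" "y = f B x"
      by (auto simp: fixed_space_def simp flip: matrix_vector_mul_assoc)
    \<comment> \<open>As \<open>A\<close> maps \<open>B *v x\<close> back to \<open>x\<close>, the
      displacement of \<open>x\<close> under \<open>B\<close> is that of \<open>- (B *v x)\<close>
      under \<open>A\<close>.\<close>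
    have "y = f A (- (B *v x))" using x
      by (simp add: f_def linear_neg[OF matrix_vector_mul_linear])
    then show "y \<in> I A \<inter> I B" using x(2) unfolding I_def by (metis IntI rangeI)
  qed
  then have "dim (f B ` fixed_space (A ** B)) \<le> dim (I A \<inter> I B)" by (rule dim_subset)
  moreover have "fixed_space (A ** B) \<inter> {x. f B x = 0} = fixed_space A \<inter> fixed_space B"
    by (auto simp: fixed_space_def f_def simp flip: matrix_vector_mul_assoc)
  ultimately have "dim (fixed_space (A ** B)) \<le> dim (I A \<inter> I B) + dim (fixed_space A \<inter> fixed_space B)"
    using dim_image_kernel[OF lin[of B] subspace_fixed_space, of "A ** B"] by simp
  then show ?thesis using dimI[of A] dimI[of B] dimW dimFT by linarith
qed

lemma norm_matrix_vector_le: "norm (A *v x) \<le> norm A * norm x" for A :: "real^'n^'m"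
proof -
  have "norm (A *v x) = L2_set (\<lambda>i. \<bar>A$i \<bullet> x\<bar>) UNIV"
    by (simp add: norm_vec_def[of "A *v x"] matrix_vector_mul_component)
  also have "\<dots> \<le> L2_set (\<lambda>i. norm (A$i) * norm x) UNIV"
    by (intro L2_set_mono Cauchy_Schwarz_ineq2) auto
  also have "\<dots> = norm A * norm x"
    by (simp add: norm_vec_def[of A] L2_set_left_distrib)
  finally show ?thesis .
qed

lemma norm_transpose: "norm (transpose A) = norm A" for A :: "real^'n^'m"
proof -
  have "transpose A \<bullet> transpose A = A \<bullet> A"
    unfolding inner_vec_def transpose_def by (subst sum.swap) simp
  then show ?thesis by (simp add: norm_eq_sqrt_inner)
qed

lemma transpose_diff: "transpose (A - B) = transpose A - transpose B" for A B :: "real^'n^'m"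
  by (simp add: transpose_def vec_eq_iff)

lemma continuous_on_mpow: "continuous_on UNIV (\<lambda>M :: real^'n^'n. mpow M k)"
proof (induction k)
  case (Suc k)
  then show ?case unfolding mpow.simps matrix_matrix_mult_def by (intro continuous_intros)
qed (simp add: continuous_on_const)

text \<open>The sum of the powers of \<open>M\<close> below \<open>n\<close> maps into the fixed
  space of \<open>M\<close>, depends continuously on \<open>M\<close>, and for \<open>M0\<close> is
  \<open>n\<close> times the identity on the fixed space. A deviation below 1 keeps it injective
  there, because \<open>n\<close> is at least 1.\<close>

lemma dim_fixed_space_finite_order_lower_semicontinuous:
  fixes M0 :: "real^'n^'n"
  assumes n: "n > 0" and ord: "mpow M0 n = mat 1"
  shows "\<exists>\<delta>>0. \<forall>M. dist M M0 < \<delta> \<longrightarrow> mpow M n = mat 1 \<longrightarrow> dim (fixed_space M0) \<le> dim (fixed_space M)"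
proof -
  define p where "p M = (\<Sum>k<n. mpow M k)" for M :: "real^'n^'n"
  have "continuous_on UNIV p" unfolding p_def by (intro continuous_on_sum continuous_on_mpow)
  then obtain \<delta> where \<delta>: "\<delta> > 0" "\<And>M. dist M M0 < \<delta> \<Longrightarrow> dist (p M) (p M0) < 1"
    unfolding continuous_on_iff by (metis UNIV_I zero_less_one)
  have p_apply: "p M *v x = (\<Sum>k<n. mpow M k *v x)" for M x
    unfolding p_def by (induction n) (simp_all add: matrix_vector_mult_add_rdistrib)
  have "dim (fixed_space M0) \<le> dim (fixed_space M)" if M: "dist M M0 < \<delta>" "mpow M n = mat 1" for M
  proof -
    have "inj_on ((*v) (p M)) (fixed_space M0)"
    proof (subst linear_injective_on_subspace_0[OF matrix_vector_mul_linear subspace_fixed_space],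
        intro ballI impI, rule ccontr)
      fix x assume x: "x \<in> fixed_space M0" "p M *v x = 0" "x \<noteq> 0"
      have "mpow M0 k *v x = x" for k
        using x(1) by (induction k) (simp_all add: fixed_space_def flip: matrix_vector_mul_assoc)
      then have "p M0 *v x = real n *\<^sub>R x" by (simp only: p_apply sum_constant_scaleR card_lessThan)
      then have "real n * norm x = norm ((p M - p M0) *v x)"
        using x(2) by (simp add: matrix_vector_mult_diff_rdistrib)
      also have "\<dots> \<le> norm (p M - p M0) * norm x" by (rule norm_matrix_vector_le)
      also have "\<dots> < 1 * norm x"
        using \<delta>(2)[OF M(1)] x(3) by (intro mult_strict_right_mono) (auto simp: dist_norm)
      also have "\<dots> \<le> real n * norm x" using n by (intro mult_right_mono) auto
      finally show False by simp
    qed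
    moreover have span: "span (fixed_space M0) = fixed_space M0"
      using subspace_fixed_space span_eq_iff by blast
    ultimately have "dim (fixed_space M0) = dim ((*v) (p M) ` fixed_space M0)"
      by (intro eucl.dim_image_eq[symmetric] matrix_vector_mul_linear) (simp only: span)
    also have "\<dots> \<le> dim (fixed_space M)"
    proof (rule dim_subset, clarify)
      fix x
      have "M *v (p M *v x) = (\<Sum>k<n. mpow M (Suc k) *v x)"
        by (simp add: p_apply linear_sum[OF matrix_vector_mul_linear] matrix_vector_mul_assoc)
      also have "\<dots> = p M *v x"
        using sum.lessThan_Suc_shift[of "\<lambda>k. mpow M k *v x" n] M(2) by (simp add: p_apply)
      finally show "p M *v x \<in> fixed_space M" by (simp add: fixed_space_def)
    qed
    finally show ?thesis .
  qed
  then show ?thesis using \<delta>(1) by blast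
qed

text \<open>If \<open>S\<close> is an \<open>A\<close>-invariant inner product, then \<open>A\<^sup>T S (A - 1) = (1 - A\<^sup>T) S\<close>; in odd
  dimension this makes \<open>det (A - 1)\<close> its own negative.\<close>

lemma finite_order_fixed_vector:
  fixes A :: "real^3^3"
  assumes det: "det A = 1" and n: "n > 0" and ord: "mpow A n = mat 1"
  obtains u where "u \<noteq> 0" "A *v u = u"
proof -
  have neg: "det (- B) = - det B" for B :: "real^3^3" by (simp add: det_3)
  define S where "S = (\<Sum>j<n. transpose (mpow A j) ** mpow A j)"
  have sum_mult: "X ** (\<Sum>j<n. f j) ** Y = (\<Sum>j<n. X ** f j ** Y)" for X Y :: "real^3^3" and f
    by (induction n) (simp_all add: matrix_add_ldistrib matrix_add_rdistrib)
  have S_apply: "S *v x = (\<Sum>j<n. transpose (mpow A j) *v (mpow A j *v x))" for x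
    unfolding S_def by (induction n)
      (simp_all add: matrix_vector_mult_add_rdistrib del: transpose_matrix_vector flip: matrix_vector_mul_assoc)
  have inv: "transpose A ** S ** A = S"
  proof -
    have "transpose A ** S ** A = (\<Sum>j<n. transpose (mpow A j ** A) ** (mpow A j ** A))"
      unfolding S_def sum_mult by (simp add: matrix_transpose_mul matrix_mul_assoc)
    also have "\<dots> = (\<Sum>j<n. transpose (mpow A (Suc j)) ** mpow A (Suc j))"
      using mpow_add[of A _ 1] by simp
    also have "\<dots> = S"
      using sum.lessThan_Suc_shift[of "\<lambda>j. transpose (mpow A j) ** mpow A j" n] ord
      by (simp add: S_def)
    finally show ?thesis .
  qed
  have detS: "det S \<noteq> 0"
  proof -
    have "x = 0" if "S *v x = 0" for x
    proof -
      have "(\<Sum>j<n. (mpow A j *v x) \<bullet> (mpow A j *v x)) = (S *v x) \<bullet> x"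
        by (simp add: S_apply inner_sum_left dot_lmul_matrix)
      then have "(\<Sum>j<n. (mpow A j *v x) \<bullet> (mpow A j *v x)) = 0" using that by simp
      then have "\<forall>j\<in>{..<n}. (mpow A j *v x) \<bullet> (mpow A j *v x) = 0"
        by (subst (asm) sum_nonneg_eq_0_iff) auto
      from bspec[OF this, of 0] show ?thesis using n by simp
    qed
    then have "inj ((*v) S)"
      by (simp add: linear_injective_0)
    then show ?thesis using det_nz_iff_inj[OF matrix_vector_mul_linear, of S]
      by (simp add: matrix_of_matrix_vector_mul)
  qed
  have "transpose A ** S ** (A - mat 1) = (mat 1 - transpose A) ** S"
    using inv by (simp add: matrix_diff_distrib)
  then have "det (transpose A) * det S * det (A - mat 1) = det (mat 1 - transpose A) * det S"
    by (metis det_mul)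
  then have "det (A - mat 1) = det (mat 1 - transpose A)"
    using detS det by simp
  also have "mat 1 - transpose A = transpose (- (A - mat 1))"
    by (simp add: transpose_def vec_eq_iff mat_def)
  also have "det \<dots> = - det (A - mat 1)"
    unfolding det_transpose by (rule neg)
  finally have "det (A - mat 1) = 0" by simp
  then have "\<not> inj ((*v) (A - mat 1))"
    using det_nz_iff_inj[OF matrix_vector_mul_linear, of "A - mat 1"]
    by (simp add: matrix_of_matrix_vector_mul)
  then obtain u where "u \<noteq> 0" "(A - mat 1) *v u = 0"
    using linear_injective_0[OF matrix_vector_mul_linear] by blast
  then show thesis using that by (simp add: matrix_vector_mult_diff_rdistrib)
qed

section \<open>Block matrices in dimension 4\<close>

definition embed4 :: "real^3 \<Rightarrow> real^4" where
  "embed4 u = vector [u$1, u$2, u$3, 0]"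

definition proj3 :: "real^4 \<Rightarrow> real^3" where
  "proj3 v = vector [v$1, v$2, v$3]"

lemma vector_4 [simp]:
  "(vector [x, y, z, w] :: 'a::zero^4) $ 1 = x" "(vector [x, y, z, w] :: 'a::zero^4) $ 2 = y"
  "(vector [x, y, z, w] :: 'a::zero^4) $ 3 = z" "(vector [x, y, z, w] :: 'a::zero^4) $ 4 = w"
  by (simp_all add: vector_def)

lemmas block4_simps = vec_eq_iff forall_3 forall_4 sum_3 sum_4 SL3_to_SL4_def embed4_def proj3_def
  matrix_vector_mult_def vector_matrix_mult_def matrix_matrix_mult_def transpose_def mat_def

lemma SL3_to_SL4_mult: "SL3_to_SL4 (A ** B) = SL3_to_SL4 A ** SL3_to_SL4 B"
  by (simp add: block4_simps)

lemma SL3_to_SL4_one: "SL3_to_SL4 (mat 1) = mat 1"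
  by (simp add: block4_simps)

lemma SL3_to_SL4_mpow: "SL3_to_SL4 (mpow A k) = mpow (SL3_to_SL4 A) k"
  by (induction k) (simp_all add: SL3_to_SL4_mult SL3_to_SL4_one)

lemma SL3_to_SL4_transpose: "SL3_to_SL4 (transpose A) = transpose (SL3_to_SL4 A)"
  by (simp add: block4_simps)

lemma SL3_to_SL4_inject: "SL3_to_SL4 A = SL3_to_SL4 B \<longleftrightarrow> A = B"
  by (auto simp: block4_simps)

lemma det_SL3_to_SL4: "det (SL3_to_SL4 A) = det A"
  by (simp add: det_4 det_3 SL3_to_SL4_def algebra_simps)

lemma norm_embed4: "norm (embed4 u) = norm u"
  by (simp add: norm_eq_sqrt_inner inner_vec_def sum_3 sum_4 embed4_def)

lemma SL3_to_SL4_embed4: "SL3_to_SL4 A *v embed4 u = embed4 (A *v u)"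
  by (simp add: block4_simps)

lemma SL3_to_SL4_displacement: "SL3_to_SL4 A *v v - v = embed4 (A *v proj3 v - proj3 v)"
  by (simp add: block4_simps algebra_simps)

lemma norm_proj3_le: "norm v \<le> norm (proj3 v) + \<bar>v$4\<bar>"
proof -
  have "v = embed4 (proj3 v) + v$4 *\<^sub>R axis 4 1"
    by (simp add: block4_simps axis_def)
  then have "norm v \<le> norm (embed4 (proj3 v)) + norm (v$4 *\<^sub>R (axis 4 1 :: real^4))"
    by (metis norm_triangle_ineq)
  then show ?thesis by (simp add: norm_embed4)
qed

lemma dim_fixed_space_SL3_to_SL4:
  assumes "det A = 1" "n > 0" "mpow A n = mat 1"
  shows "dim (fixed_space (SL3_to_SL4 A)) \<ge> 2"
proof -
  obtain u where u: "u \<noteq> 0" "A *v u = u" using finite_order_fixed_vector[OF assms] .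
  let ?B = "{embed4 u, axis 4 1}"
  have ne: "embed4 u \<noteq> 0" using u(1) norm_embed4[of u] by auto
  have orth: "orthogonal (embed4 u) (axis 4 1)"
    by (simp add: orthogonal_def inner_axis embed4_def)
  have neq: "embed4 u \<noteq> axis 4 1" by (simp add: block4_simps axis_def)
  have "independent ?B"
    using orth ne by (intro pairwise_orthogonal_independent)
      (auto simp: pairwise_def orthogonal_commute axis_eq_0_iff)
  moreover have "?B \<subseteq> fixed_space (SL3_to_SL4 A)"
    using u(2) by (auto simp: fixed_space_def SL3_to_SL4_embed4) (simp add: block4_simps axis_def)
  ultimately have "card ?B \<le> dim (fixed_space (SL3_to_SL4 A))"
    using independent_card_le_dim by blast
  then show ?thesis using neq by simp
qed

text \<open>The joint displacement under \<open>a\<close> and \<open>b\<close> is injective, hence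
  bounded below by a constant \<open>c\<close>. For a common fixed vector of matrices within
  \<open>c / 8\<close> of the blocks this displacement is at most \<open>c / 4\<close> times its
  norm, so \<open>proj3 v\<close> has at most a quarter of the norm of \<open>v\<close>, which
  amounts to a third of the last coordinate.\<close>

lemma nearby_common_fixed_vector_bound:
  fixes a b :: "real^3^3"
  assumes no_fixed: "\<And>u. \<lbrakk>a *v u = u; b *v u = u\<rbrakk> \<Longrightarrow> u = 0"
  shows "\<exists>\<delta>>0. \<forall>A B v. dist A (SL3_to_SL4 a) < \<delta> \<longrightarrow> dist B (SL3_to_SL4 b) < \<delta> \<longrightarrow>
    A *v v = v \<longrightarrow> B *v v = v \<longrightarrow> norm (proj3 v) \<le> \<bar>v$4\<bar> / 3"
proof -
  define f where "f u = (a *v u - u, b *v u - u)" for u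
  have lin: "linear f"
    by (rule linearI) (simp_all add: f_def matrix_vector_right_distrib matrix_vector_mult_scaleR
        scaleR_diff_right)
  have "inj f" unfolding linear_injective_0[OF lin] using no_fixed by (simp add: f_def zero_prod_def)
  then obtain c where c: "c > 0" "\<And>u. c * norm u \<le> norm (f u)"
    using linear_inj_bounded_below_pos[OF lin] by metis
  have "norm (proj3 v) \<le> \<bar>v$4\<bar> / 3"
    if A: "dist A (SL3_to_SL4 a) < c / 8" and B: "dist B (SL3_to_SL4 b) < c / 8"
      and v: "A *v v = v" "B *v v = v" for A B v
  proof -
    have *: "norm (g *v proj3 v - proj3 v) \<le> c / 8 * norm v"
      if "dist M (SL3_to_SL4 g) < c / 8" "M *v v = v" for M g
    proof -
      have "norm (g *v proj3 v - proj3 v) = norm (SL3_to_SL4 g *v v - v)"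
        by (simp only: SL3_to_SL4_displacement norm_embed4)
      also have "SL3_to_SL4 g *v v - v = (SL3_to_SL4 g - M) *v v"
        by (simp add: matrix_vector_mult_diff_rdistrib that(2))
      also have "norm \<dots> \<le> norm (SL3_to_SL4 g - M) * norm v" by (rule norm_matrix_vector_le)
      also have "\<dots> \<le> c / 8 * norm v"
        using that(1) by (intro mult_right_mono) (auto simp: dist_norm norm_minus_commute)
      finally show ?thesis .
    qed
    have "c * norm (proj3 v) \<le> norm (f (proj3 v))" by (rule c(2))
    also have "\<dots> \<le> norm (a *v proj3 v - proj3 v) + norm (b *v proj3 v - proj3 v)"
      unfolding f_def by (rule norm_Pair_le)
    also have "\<dots> \<le> c / 8 * norm v + c / 8 * norm v"
      using *[OF A v(1)] *[OF B v(2)] by (rule add_mono)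
    finally have "c * norm (proj3 v) \<le> c * (norm v / 4)" by simp
    then have "norm (proj3 v) \<le> norm v / 4" using c(1) by simp
    then show ?thesis using norm_proj3_le[of v] by linarith
  qed
  then show ?thesis using c(1) by (intro exI[of _ "c / 8"]) auto
qed

text \<open>For a fixed covector \<open>\<phi>\<close> with last entry 1, this is the action of
  \<open>S\<close> on the kernel of \<open>\<phi>\<close> in the basis
  \<open>e_i - \<phi>_i e_4\<close>: coordinates in this basis are the first three entries.\<close>

definition block_part :: "real^4 \<Rightarrow> real^4^4 \<Rightarrow> real^3^3" where
  "block_part \<phi> S = vector
     [vector [S$1$1 - \<phi>$1 * S$1$4, S$1$2 - \<phi>$2 * S$1$4, S$1$3 - \<phi>$3 * S$1$4],
      vector [S$2$1 - \<phi>$1 * S$2$4, S$2$2 - \<phi>$2 * S$2$4, S$2$3 - \<phi>$3 * S$2$4],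
      vector [S$3$1 - \<phi>$1 * S$3$4, S$3$2 - \<phi>$2 * S$3$4, S$3$3 - \<phi>$3 * S$3$4]]"

text \<open>The columns of the conjugating matrix are the basis \<open>e\<^sub>i - \<phi>\<^sub>i e\<^sub>4\<close> of the kernel of \<open>\<phi>\<close>
  and a multiple of the fixed vector \<open>v\<close> chosen to make the determinant 1.\<close>

lemma conjugate_to_block:
  fixes \<phi> v :: "real^4"
  assumes "\<phi>$4 = 1" and \<phi>v: "\<phi> \<bullet> v \<noteq> 0"
  obtains P where "det P = 1"
    "\<And>S. \<lbrakk>\<phi> v* S = \<phi>; S *v v = v\<rbrakk> \<Longrightarrow> S ** P = P ** SL3_to_SL4 (block_part \<phi> S)"
proof -
  define s where "s = inverse (\<phi> \<bullet> v)"
  define P :: "real^4^4" where "P = vector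
    [vector [1, 0, 0, s * v$1], vector [0, 1, 0, s * v$2], vector [0, 0, 1, s * v$3],
     vector [- \<phi>$1, - \<phi>$2, - \<phi>$3, s * v$4]]"
  have "det P = s * (\<phi> \<bullet> v)"
    by (simp add: det_4 P_def inner_vec_def sum_4 assms(1) algebra_simps)
  then have "det P = 1" using \<phi>v by (simp add: s_def)
  moreover have "S ** P = P ** SL3_to_SL4 (block_part \<phi> S)"
    if \<phi>: "\<phi> v* S = \<phi>" and v: "S *v v = v" for S
  proof -
    \<comment> \<open>Since the last entry of \<open>\<phi>\<close> is 1, its invariance can be
      solved for the last row of \<open>S\<close>.\<close>
    have r: "S$4$4 = 1 - \<phi>$1 * S$1$4 - \<phi>$2 * S$2$4 - \<phi>$3 * S$3$4"
      "S$4$1 = \<phi>$1 - \<phi>$1 * S$1$1 - \<phi>$2 * S$2$1 - \<phi>$3 * S$3$1"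
      "S$4$2 = \<phi>$2 - \<phi>$1 * S$1$2 - \<phi>$2 * S$2$2 - \<phi>$3 * S$3$2"
      "S$4$3 = \<phi>$3 - \<phi>$1 * S$1$3 - \<phi>$2 * S$2$3 - \<phi>$3 * S$3$3"
      using \<phi> assms(1) by (simp_all add: vec_eq_iff forall_4 vector_matrix_mult_def sum_4 algebra_simps)
    have "(S ** P)$i$4 = s * (S *v v)$i" for i
      by (simp add: P_def matrix_matrix_mult_def matrix_vector_mult_def sum_4 algebra_simps)
    then have col4: "(S ** P)$i$4 = s * v$i" for i by (simp add: v)
    have "(S ** P)$i$4 = (P ** SL3_to_SL4 (block_part \<phi> S))$i$4" for i
      unfolding col4 using exhaust_4[of i]
      by (auto simp: P_def SL3_to_SL4_def matrix_matrix_mult_def sum_4)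
    moreover have "(S ** P)$i$j = (P ** SL3_to_SL4 (block_part \<phi> S))$i$j" if "j \<noteq> 4" for i j
      using exhaust_4[of i] exhaust_4[of j] that
      by (auto simp: P_def SL3_to_SL4_def block_part_def matrix_matrix_mult_def sum_4 r algebra_simps)
    ultimately show ?thesis unfolding vec_eq_iff by metis
  qed
  ultimately show thesis using that by blast
qed

text \<open>An entry of the block is off by the error of one entry of \<open>S\<close> plus at most
  that of an entry in the last column which should be 0, together \<open>2 * \<delta>\<close>.
  Bounding the norm by the sum over nine entries gives 18.\<close>

lemma dist_block_part_le:
  assumes "dist S (SL3_to_SL4 A) < \<delta>" and \<phi>: "\<And>i. \<bar>\<phi>$i\<bar> \<le> 1"
  shows "dist (block_part \<phi> S) A \<le> 18 * \<delta>"
proof -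
  have e: "\<bar>S$i$j - SL3_to_SL4 A$i$j\<bar> \<le> \<delta>" for i j
  proof -
    have "\<bar>(S - SL3_to_SL4 A)$i$j\<bar> \<le> norm ((S - SL3_to_SL4 A)$i)" by (rule component_le_norm_cart)
    also have "\<dots> \<le> norm (S - SL3_to_SL4 A)" by (rule Finite_Cartesian_Product.norm_nth_le)
    finally show ?thesis using assms(1) by (simp add: dist_norm)
  qed
  have two: "\<bar>x - f * y - z\<bar> \<le> 2 * \<delta>" if "\<bar>x - z\<bar> \<le> \<delta>" "\<bar>y\<bar> \<le> \<delta>" "\<bar>f\<bar> \<le> 1" for x y z f :: real
  proof -
    have "\<bar>f * y\<bar> \<le> 1 * \<delta>" unfolding abs_mult using that by (intro mult_mono) auto
    then show ?thesis using that by linarith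
  qed
  have "\<bar>(block_part \<phi> S - A)$i$j\<bar> \<le> 2 * \<delta>" for i j
    using exhaust_3[of i] exhaust_3[of j] e[of 1 1] e[of 1 2] e[of 1 3] e[of 1 4]
      e[of 2 1] e[of 2 2] e[of 2 3] e[of 2 4] e[of 3 1] e[of 3 2] e[of 3 3] e[of 3 4]
    by (auto simp: block_part_def SL3_to_SL4_def intro!: two \<phi>)
  then have "norm ((block_part \<phi> S - A)$i) \<le> 6 * \<delta>" for i
  proof -
    have "norm ((block_part \<phi> S - A)$i) \<le> (\<Sum>j\<in>UNIV. \<bar>(block_part \<phi> S - A)$i$j\<bar>)" by (rule norm_le_l1_cart)
    also have "\<dots> \<le> (\<Sum>j\<in>(UNIV :: 3 set). 2 * \<delta>)"
      by (intro sum_mono) (rule \<open>\<And>i j. \<bar>(block_part \<phi> S - A)$i$j\<bar> \<le> 2 * \<delta>\<close>)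
    finally show ?thesis by simp
  qed
  then have "(\<Sum>i\<in>UNIV. norm ((block_part \<phi> S - A)$i)) \<le> (\<Sum>i\<in>(UNIV :: 3 set). 6 * \<delta>)"
    by (intro sum_mono)
  moreover have "norm (block_part \<phi> S - A) \<le> (\<Sum>i\<in>UNIV. norm ((block_part \<phi> S - A)$i))"
    unfolding norm_vec_def[of "block_part \<phi> S - A"] by (rule L2_set_le_sum) simp
  ultimately show ?thesis by (simp add: dist_norm)
qed

section \<open>Representations of presented groups\<close>

lemma hom_SL_word:
  fixes \<sigma> :: "'s word set \<Rightarrow> real^'n^'n"
  assumes "\<sigma> \<in> hom (presented_group R) SL"
  shows "det (\<sigma> (word_class R u)) = 1"
    and "\<sigma> (word_class R (u @ v)) = \<sigma> (word_class R u) ** \<sigma> (word_class R v)"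
    and "\<sigma> (word_class R []) = mat 1"
    and "\<sigma> (word_class R (concat (replicate k u))) = mpow (\<sigma> (word_class R u)) k"
    and "\<sigma> (word_class R (replicate k x)) = mpow (\<sigma> (word_class R [x])) k"
    and "word_eq R u v \<Longrightarrow> \<sigma> (word_class R u) = \<sigma> (word_class R v)"
    and "\<sigma> (word_class R [(s, b)]) ** \<sigma> (word_class R [(s, \<not> b)]) = mat 1"
proof -
  have mem: "word_class R u \<in> carrier (presented_group R)" for u by (simp add: presented_group_def)
  show det: "det (\<sigma> (word_class R u)) = 1" for u
    using hom_in_carrier[OF assms mem] by (simp add: SL_def)
  show app: "\<sigma> (word_class R (u @ v)) = \<sigma> (word_class R u) ** \<sigma> (word_class R v)" for u v
    using hom_mult[OF assms mem mem, of u v] by (simp add: SL_def)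
  show nil: "\<sigma> (word_class R []) = mat 1"
  proof -
    let ?X = "\<sigma> (word_class R [])"
    obtain Y where Y: "Y ** ?X = mat 1"
      using det[of "[]"] by (metis invertible_det_nz invertible_def zero_neq_one)
    \<comment> \<open>An invertible idempotent is the identity.\<close>
    have "?X ** ?X = ?X" using app[of "[]" "[]"] by simp
    then have "(Y ** ?X) ** ?X = Y ** ?X" by (simp flip: matrix_mul_assoc)
    then show ?thesis by (simp add: Y)
  qed
  show "\<sigma> (word_class R (concat (replicate k u))) = mpow (\<sigma> (word_class R u)) k"
    by (induction k) (simp_all add: nil app)
  show "\<sigma> (word_class R (replicate k x)) = mpow (\<sigma> (word_class R [x])) k"
  proof (induction k)
    case (Suc k)
    then show ?case using app[of "[x]" "replicate k x"] by simp
  qed (simp add: nil)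
  show eq: "word_eq R u v \<Longrightarrow> \<sigma> (word_class R u) = \<sigma> (word_class R v)" for u v
    by (metis word_class_eq_iff)
  show "\<sigma> (word_class R [(s, b)]) ** \<sigma> (word_class R [(s, \<not> b)]) = mat 1"
    using eq[OF word_eq.cancel[of R s b]] app[of "[(s, b)]" "[(s, \<not> b)]"] nil by simp
qed

text \<open>The product relation makes the image of the third generator the inverse of the product
  of the other two, so these two suffice as a start. This carries a fixed vector or covector from
  two generators to the whole group.\<close>

lemma hom_SL_induct:
  fixes \<sigma> :: "cone word set \<Rightarrow> real^'n^'n"
  assumes \<sigma>: "\<sigma> \<in> hom (orbifold_pi1 T) SL" and g: "g \<in> carrier (orbifold_pi1 T)"
    and gen: "P (\<sigma> (pi1_gen T C1))" "P (\<sigma> (pi1_gen T C2))"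
    and one: "P (mat 1)" and mult: "\<And>X Y. \<lbrakk>P X; P Y\<rbrakk> \<Longrightarrow> P (X ** Y)"
    and inv: "\<And>X Y. \<lbrakk>P X; X ** Y = mat 1\<rbrakk> \<Longrightarrow> P Y"
  shows "P (\<sigma> g)"
proof -
  let ?R = "turnover_relators T"
  note w = hom_SL_word[OF \<sigma>]
  have "[(C1, True), (C2, True), (C3, True)] \<in> ?R" by (simp add: turnover_relators_def)
  then have "\<sigma> (word_class ?R ([(C1, True)] @ [(C2, True)] @ [(C3, True)])) = mat 1"
    using w(6)[OF word_eq.relator] w(3) by simp
  then have "(\<sigma> (pi1_gen T C1) ** \<sigma> (pi1_gen T C2)) ** \<sigma> (pi1_gen T C3) = mat 1"
    unfolding w(2) by (simp add: pi1_gen_def matrix_mul_assoc)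
  then have "P (\<sigma> (pi1_gen T C3))" using inv mult gen by blast
  then have pos: "P (\<sigma> (word_class ?R [(s, True)]))" for s
    using gen by (cases s) (simp_all add: pi1_gen_def)
  then have letter: "P (\<sigma> (word_class ?R [(s, b)]))" for s b
    using inv[OF pos[of s]] w(7)[of s True] by (cases b) auto
  have "P (\<sigma> (word_class ?R u))" for u
  proof (induction u)
    case (Cons x u)
    then show ?case using mult letter[of "fst x" "snd x"] w(2)[of "[x]" u] by simp
  qed (simp add: w(3) one)
  then show ?thesis using g by (auto simp: presented_group_def)
qed

lemma pi1_gen_order:
  assumes "\<sigma> \<in> hom (orbifold_pi1 T) SL"
  shows "mpow (\<sigma> (pi1_gen T i)) (cone_order T i) = mat 1"
proof -
  have "replicate (cone_order T i) (i, True) \<in> turnover_relators T"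
    unfolding turnover_relators_def by blast
  from hom_SL_word(6)[OF assms word_eq.relator[OF this]]
  show ?thesis by (simp add: hom_SL_word(3,5)[OF assms] pi1_gen_def)
qed

lemma pi1_gen_in_carrier: "pi1_gen T i \<in> carrier (orbifold_pi1 T)"
  by (simp add: pi1_gen_def presented_group_def)

lemma pi1_gen_relation:
  fixes \<sigma> :: "cone word set \<Rightarrow> real^'n^'n"
  assumes "\<sigma> \<in> hom (orbifold_pi1 T) SL"
  shows "\<sigma> (pi1_gen T C1) ** \<sigma> (pi1_gen T C2) ** \<sigma> (pi1_gen T C3) = mat 1"
proof -
  have "[(C1, True), (C2, True), (C3, True)] \<in> turnover_relators T" by (simp add: turnover_relators_def)
  from hom_SL_word(6)[OF assms word_eq.relator[OF this]]
  show ?thesis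
    using hom_SL_word(2)[OF assms, of "[(C1, True)]" "[(C2, True), (C3, True)]"]
      hom_SL_word(2)[OF assms, of "[(C2, True)]" "[(C3, True)]"]
    by (simp add: hom_SL_word(3)[OF assms] pi1_gen_def matrix_mul_assoc)
qed

text \<open>A vector of \<open>F\<close> with last coordinate 0 vanishes by the bound, so the last
  coordinate is injective on \<open>F\<close>, and a nonzero vector can be scaled to make it
  1.\<close>

lemma subspace_near_axis4:
  fixes F :: "(real^4) set"
  assumes F: "subspace F" "\<And>v. v \<in> F \<Longrightarrow> norm (proj3 v) \<le> \<bar>v$4\<bar> / 3"
  shows "dim F \<le> 1" and "dim F \<ge> 1 \<Longrightarrow> \<exists>v\<in>F. v$4 = 1 \<and> norm (proj3 v) \<le> 1/3"
proof -
  have zero: "v = 0" if "v \<in> F" "v$4 = 0" for v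
    using F(2)[OF that(1)] norm_proj3_le[of v] that(2) by simp
  have lin: "linear (\<lambda>v :: real^4. v$4)" by (rule linearI) simp_all
  have "inj_on (\<lambda>v. v$4) F"
    using zero by (subst linear_injective_on_subspace_0[OF lin F(1)]) blast
  moreover have span: "span F = F" using F(1) span_eq_iff by blast
  ultimately have "dim ((\<lambda>v. v$4) ` F) = dim F"
    by (intro eucl.dim_image_eq lin) (simp only: span)
  then show "dim F \<le> 1" using dim_subset_UNIV[of "(\<lambda>v. v$4) ` F"] by simp
  assume "dim F \<ge> 1"
  then obtain v where v: "v \<in> F" "v \<noteq> 0" using dim_eq_0[of F] by fastforce
  then have v4: "v$4 \<noteq> 0" using zero by blast
  define u where "u = (1 / v$4) *\<^sub>R v"
  have "u \<in> F" using F(1) v(1) by (simp add: u_def subspace_scale)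
  moreover have "u$4 = 1" using v4 by (simp add: u_def)
  ultimately show "\<exists>v\<in>F. v$4 = 1 \<and> norm (proj3 v) \<le> 1/3" using F(2)[of u] by auto
qed

theorem deformation_conjugate_to_SL3:
  fixes T :: turnover and \<rho> :: "cone word set \<Rightarrow> real^3^3"
  assumes T: "turnover T" and \<rho>: "\<rho> \<in> topspace (rep_space (orbifold_pi1 T))"
    and no_vector: "\<And>v. \<lbrakk>\<rho> (pi1_gen T C1) *v v = v; \<rho> (pi1_gen T C2) *v v = v\<rbrakk> \<Longrightarrow> v = 0"
    and no_covector: "\<And>\<phi>. \<lbrakk>\<phi> v* \<rho> (pi1_gen T C1) = \<phi>; \<phi> v* \<rho> (pi1_gen T C2) = \<phi>\<rbrakk> \<Longrightarrow> \<phi> = 0"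
    and W: "openin (rep_space (orbifold_pi1 T)) W" "\<rho> \<in> W"
  shows "\<exists>V. openin (rep_space (orbifold_pi1 T)) V \<and> extend_rep (orbifold_pi1 T) \<rho> \<in> V \<and>
    (\<forall>\<sigma>\<in>V. \<exists>\<tau>\<in>W. conjugate_reps (orbifold_pi1 T) \<sigma> (extend_rep (orbifold_pi1 T) \<tau>))"
proof -
  define G where "G = orbifold_pi1 T"
  define x where "x = pi1_gen T"
  have xG: "x i \<in> carrier G" for i by (simp add: x_def G_def pi1_gen_in_carrier)
  have top: "topspace (rep_space G :: ('a \<Rightarrow> real^'n^'n) topology) = PiE (carrier G) (\<lambda>_. UNIV) \<inter> hom G SL"
    for G :: "'a monoid"
    by (simp add: rep_space_def)
  have \<rho>hom: "\<rho> \<in> hom G SL" using \<rho> unfolding top G_def by blast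
  have ord: "cone_order T i > 0" for i
  proof -
    have "cone_order T i \<ge> 2" using T by (simp add: turnover_def)
    then show ?thesis by simp
  qed
  obtain W' where W': "openin (product_topology (\<lambda>_. euclidean) (carrier G)) W'" "W = W' \<inter> hom G SL"
    using W(1) unfolding rep_space_def openin_subtopology G_def by blast
  then obtain X where X: "\<rho> \<in> PiE (carrier G) X" "\<And>i. open (X i)" "finite {i. X i \<noteq> UNIV}"
      "PiE (carrier G) X \<subseteq> W'"
    using product_topology_open_contains_basis[OF W'(1), of \<rho>] W(2) by auto
  \<comment> \<open>A basic open set of the product restricts only finitely many coordinates, so
    \<open>\<tau>\<close> has to be controlled at these alone.\<close>
  define J where "J = {g \<in> carrier G. X g \<noteq> UNIV}"
  have J: "finite J" unfolding J_def by (rule finite_subset[OF _ X(3)]) auto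
  have "\<exists>e>0. ball (\<rho> g) e \<subseteq> X g" if "g \<in> carrier G" for g
    using X(1,2) that openE by (metis PiE_E)
  then obtain e where e: "\<And>g. g \<in> carrier G \<Longrightarrow> e g > 0 \<and> ball (\<rho> g) (e g) \<subseteq> X g" by metis
  define \<epsilon> where "\<epsilon> = Min (insert 1 (e ` J))"
  have \<epsilon>: "\<epsilon> > 0" using J e by (auto simp: \<epsilon>_def J_def)
  have \<epsilon>_le: "\<epsilon> \<le> e g" if "g \<in> J" for g using J that by (simp add: \<epsilon>_def)
  have "\<exists>d>0. \<forall>M. dist M (SL3_to_SL4 (\<rho> (x i))) < d \<longrightarrow> mpow M (cone_order T i) = mat 1 \<longrightarrow>
      2 \<le> dim (fixed_space M)" for i
  proof -
    have "det (\<rho> (x i)) = 1" using hom_in_carrier[OF \<rho>hom xG] by (simp add: SL_def)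
    moreover have o: "mpow (\<rho> (x i)) (cone_order T i) = mat 1"
      unfolding x_def by (rule pi1_gen_order) (use \<rho>hom G_def in simp)
    ultimately have "2 \<le> dim (fixed_space (SL3_to_SL4 (\<rho> (x i))))"
      using dim_fixed_space_SL3_to_SL4 ord by blast
    moreover have "mpow (SL3_to_SL4 (\<rho> (x i))) (cone_order T i) = mat 1"
      using o by (metis SL3_to_SL4_mpow SL3_to_SL4_one)
    ultimately show ?thesis
      using dim_fixed_space_finite_order_lower_semicontinuous[OF ord] by (meson order_trans)
  qed
  then obtain d where d: "\<And>i. d i > 0" "\<And>i M. \<lbrakk>dist M (SL3_to_SL4 (\<rho> (x i))) < d i;
      mpow M (cone_order T i) = mat 1\<rbrakk> \<Longrightarrow> 2 \<le> dim (fixed_space M)"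
    by metis
  obtain d1 where d1: "d1 > 0" "\<And>A B v. \<lbrakk>dist A (SL3_to_SL4 (\<rho> (x C1))) < d1;
      dist B (SL3_to_SL4 (\<rho> (x C2))) < d1; A *v v = v; B *v v = v\<rbrakk> \<Longrightarrow> norm (proj3 v) \<le> \<bar>v$4\<bar> / 3"
    using nearby_common_fixed_vector_bound[of "\<rho> (x C1)" "\<rho> (x C2)"] no_vector unfolding x_def by metis
  obtain d2 where d2: "d2 > 0" "\<And>A B v. \<lbrakk>dist A (SL3_to_SL4 (transpose (\<rho> (x C1)))) < d2;
      dist B (SL3_to_SL4 (transpose (\<rho> (x C2)))) < d2; A *v v = v; B *v v = v\<rbrakk> \<Longrightarrow> norm (proj3 v) \<le> \<bar>v$4\<bar> / 3"
    using nearby_common_fixed_vector_bound[of "transpose (\<rho> (x C1))" "transpose (\<rho> (x C2))"] no_covector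
    unfolding x_def transpose_matrix_vector by metis
  \<comment> \<open>Passing to the block part costs a factor 18, so \<open>\<epsilon> / 20\<close>
    leaves strict room.\<close>
  define \<delta> where "\<delta> = Min {d C1, d C2, d C3, d1, d2, \<epsilon> / 20}"
  have \<delta>: "\<delta> > 0" using d(1) d1(1) d2(1) \<epsilon> by (simp add: \<delta>_def)
  have \<delta>_le: "\<delta> \<le> d i" "\<delta> \<le> d1" "\<delta> \<le> d2" "\<delta> \<le> \<epsilon> / 20" for i
    by (cases i; simp add: \<delta>_def)+
  \<comment> \<open>Closeness at the generators controls the fixed spaces; closeness on
    \<open>J\<close> gives membership in \<open>W\<close>.\<close>
  define K where "K = J \<union> range x"
  have UNIV_cone: "(UNIV :: cone set) = {C1, C2, C3}" using cone.exhaust by auto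
  have K: "finite K" "K \<subseteq> carrier G" using J xG by (auto simp: K_def J_def UNIV_cone)
  define Y where "Y g = (if g \<in> K then ball (SL3_to_SL4 (\<rho> g)) \<delta> else UNIV)" for g
  define V where "V = PiE (carrier G) Y \<inter> hom G SL"
  have "openin (product_topology (\<lambda>_. euclidean) (carrier G)) (PiE (carrier G) Y)"
    by (rule product_topology_basis) (auto simp: Y_def intro: finite_subset[OF _ K(1)])
  then have V_open: "openin (rep_space G) V"
    unfolding rep_space_def openin_subtopology V_def by blast
  have "extend_rep G \<rho> \<in> hom G SL"
  proof (rule homI)
    fix g assume g: "g \<in> carrier G"
    then show "extend_rep G \<rho> g \<in> carrier SL"
      using hom_in_carrier[OF \<rho>hom g] by (simp add: extend_rep_def SL_def det_SL3_to_SL4)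
    fix g' assume g': "g' \<in> carrier G"
    have "g \<otimes>\<^bsub>G\<^esub> g' \<in> carrier G"
      using g g' group_presented_group unfolding G_def by (meson group.is_monoid monoid.m_closed)
    then show "extend_rep G \<rho> (g \<otimes>\<^bsub>G\<^esub> g') = extend_rep G \<rho> g \<otimes>\<^bsub>SL\<^esub> extend_rep G \<rho> g'"
      using g g' hom_mult[OF \<rho>hom g g'] by (simp add: extend_rep_def SL_def SL3_to_SL4_mult)
  qed
  then have \<rho>V: "extend_rep G \<rho> \<in> V"
    using K(2) \<delta> by (auto simp: V_def Y_def extend_rep_def)
  have "\<exists>\<tau>\<in>W. conjugate_reps G \<sigma> (extend_rep G \<tau>)" if \<sigma>: "\<sigma> \<in> V" for \<sigma>
  proof -
    have \<sigma>hom: "\<sigma> \<in> hom G SL" using \<sigma> by (simp add: V_def)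
    have near: "dist (\<sigma> g) (SL3_to_SL4 (\<rho> g)) < \<delta>" if "g \<in> K" for g
    proof -
      have "\<sigma> g \<in> Y g" using \<sigma> K(2) that by (auto simp: V_def)
      then show ?thesis using that by (simp add: Y_def dist_commute)
    qed
    have near_x: "dist (\<sigma> (x i)) (SL3_to_SL4 (\<rho> (x i))) < \<delta>" for i
      by (rule near) (simp add: K_def)
    have near_t: "dist (transpose (\<sigma> (x i))) (SL3_to_SL4 (transpose (\<rho> (x i)))) < \<delta>" for i
      using near_x[of i] unfolding SL3_to_SL4_transpose dist_norm
      by (simp add: norm_transpose flip: transpose_diff)
    define A B C where "A = \<sigma> (x C1)" and "B = \<sigma> (x C2)" and "C = \<sigma> (x C3)"
    have ABC: "A ** B ** C = mat 1"
      unfolding A_def B_def C_def x_def by (rule pi1_gen_relation) (use \<sigma>hom G_def in simp)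
    have "2 \<le> dim (fixed_space (\<sigma> (x i)))" for i
    proof (rule d(2))
      show "dist (\<sigma> (x i)) (SL3_to_SL4 (\<rho> (x i))) < d i"
        using near_x[of i] \<delta>_le(1)[of i] by simp
      show "mpow (\<sigma> (x i)) (cone_order T i) = mat 1"
        unfolding x_def by (rule pi1_gen_order) (use \<sigma>hom G_def in simp)
    qed
    then have dims: "2 \<le> dim (fixed_space A)" "2 \<le> dim (fixed_space B)" "2 \<le> dim (fixed_space C)"
      by (simp_all add: A_def B_def C_def)
    \<comment> \<open>By the relation, \<open>A ** B\<close> is the inverse of
      \<open>C\<close>.\<close>
    have "fixed_space C \<subseteq> fixed_space (A ** B)"
    proof
      fix v assume "v \<in> fixed_space C"
      then have "(A ** B) *v v = (A ** B) *v (C *v v)" by (simp add: fixed_space_def)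
      also have "\<dots> = v" by (simp add: matrix_vector_mul_assoc ABC)
      finally show "v \<in> fixed_space (A ** B)" by (simp add: fixed_space_def)
    qed
    then have "2 \<le> dim (fixed_space (A ** B))" using dims(3) dim_subset order_trans by blast
    moreover define F F' where "F = fixed_space A \<inter> fixed_space B"
      and "F' = fixed_space (transpose A) \<inter> fixed_space (transpose B)"
    ultimately have count: "2 \<le> dim F + dim F'"
      using dim_fixed_spaces_le[of A B] dims by simp
    have F: "subspace F" "subspace F'"
      unfolding F_def F'_def by (intro subspace_inter subspace_fixed_space)+
    have F_bd: "norm (proj3 v) \<le> \<bar>v$4\<bar> / 3" if "v \<in> F" for v
      using that near_x[of C1] near_x[of C2] \<delta>_le(2)
      by (intro d1(2)[of A B]) (auto simp: F_def fixed_space_def A_def B_def)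
    have F'_bd: "norm (proj3 v) \<le> \<bar>v$4\<bar> / 3" if "v \<in> F'" for v
      using that near_t[of C1] near_t[of C2] \<delta>_le(3)
      by (intro d2(2)[of "transpose A" "transpose B"]) (auto simp: F'_def fixed_space_def A_def B_def)
    have "dim F \<ge> 1" "dim F' \<ge> 1"
      using count subspace_near_axis4(1)[OF F(1) F_bd] subspace_near_axis4(1)[OF F(2) F'_bd] by linarith+
    then obtain v \<phi> where v: "v \<in> F" "v$4 = 1" "norm (proj3 v) \<le> 1/3"
      and \<phi>: "\<phi> \<in> F'" "\<phi>$4 = 1" "norm (proj3 \<phi>) \<le> 1/3"
      using subspace_near_axis4(2)[OF F(1) F_bd] subspace_near_axis4(2)[OF F(2) F'_bd] by blast
    \<comment> \<open>Both vectors are close to the last axis, so their pairing differs from 1 by at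
      most 1/9; hence \<open>v\<close> is transverse to the kernel of \<open>\<phi>\<close>.\<close>
    have "\<phi> \<bullet> v = proj3 \<phi> \<bullet> proj3 v + 1"
      by (simp add: inner_vec_def sum_3 sum_4 proj3_def v(2) \<phi>(2))
    moreover have "\<bar>proj3 \<phi> \<bullet> proj3 v\<bar> \<le> 1/3 * (1/3)"
      using v(3) \<phi>(3) by (intro order_trans[OF Cauchy_Schwarz_ineq2] mult_mono) auto
    ultimately have \<phi>v: "\<phi> \<bullet> v \<noteq> 0" by linarith
    have \<phi>_le: "\<bar>\<phi>$i\<bar> \<le> 1" for i
    proof -
      have "\<bar>proj3 \<phi> $ j\<bar> \<le> 1" for j
        using component_le_norm_cart[of "proj3 \<phi>" j] \<phi>(3) by linarith
      from this[of 1] this[of 2] this[of 3] show ?thesis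
        using exhaust_4[of i] \<phi>(2) by (auto simp: proj3_def)
    qed
    obtain P where P: "det P = 1"
      "\<And>S. \<lbrakk>\<phi> v* S = \<phi>; S *v v = v\<rbrakk> \<Longrightarrow> S ** P = P ** SL3_to_SL4 (block_part \<phi> S)"
      using conjugate_to_block[OF \<phi>(2) \<phi>v] by blast
    have PP: "P ** matrix_inv P = mat 1" "matrix_inv P ** P = mat 1"
      using P(1) invertible_det_nz[of P] someI_ex[of "\<lambda>P'. P ** P' = mat 1 \<and> P' ** P = mat 1"]
      by (auto simp: invertible_def matrix_inv_def)
    have \<sigma>hom': "\<sigma> \<in> hom (orbifold_pi1 T) SL" using \<sigma>hom by (simp add: G_def)
    have fix_v: "\<sigma> g *v v = v" if "g \<in> carrier G" for g
    proof (rule hom_SL_induct[OF \<sigma>hom' that[unfolded G_def], where P = "\<lambda>X. X *v v = v"])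
      show "\<sigma> (pi1_gen T C1) *v v = v" "\<sigma> (pi1_gen T C2) *v v = v"
        using v(1) by (simp_all add: F_def fixed_space_def A_def B_def x_def)
      fix X Y :: "real^4^4"
      show "(X ** Y) *v v = v" if "X *v v = v" "Y *v v = v"
        using that by (simp flip: matrix_vector_mul_assoc)
      show "Y *v v = v" if "X *v v = v" "X ** Y = mat 1"
        using that by (metis matrix_left_right_inverse matrix_vector_mul_assoc matrix_vector_mul_lid)
    qed simp
    have fix_\<phi>: "\<phi> v* \<sigma> g = \<phi>" if "g \<in> carrier G" for g
    proof (rule hom_SL_induct[OF \<sigma>hom' that[unfolded G_def], where P = "\<lambda>X. \<phi> v* X = \<phi>"])
      show "\<phi> v* \<sigma> (pi1_gen T C1) = \<phi>" "\<phi> v* \<sigma> (pi1_gen T C2) = \<phi>"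
        using \<phi>(1) by (simp_all add: F'_def fixed_space_def A_def B_def x_def)
      fix X Y :: "real^4^4"
      show "\<phi> v* (X ** Y) = \<phi>" if "\<phi> v* X = \<phi>" "\<phi> v* Y = \<phi>"
        using that by (simp flip: vector_matrix_mul_assoc)
      show "\<phi> v* Y = \<phi>" if "\<phi> v* X = \<phi>" "X ** Y = mat 1"
        using that by (metis vector_matrix_mul_assoc vector_matrix_mul_rid)
    qed simp
    \<comment> \<open>Restriction to the carrier makes \<open>\<tau>\<close> extensional, so that it
      can lie in the product set contained in \<open>W'\<close>.\<close>
    define \<tau> where "\<tau> = restrict (\<lambda>g. block_part \<phi> (\<sigma> g)) (carrier G)"
    have \<tau>: "\<sigma> g ** P = P ** SL3_to_SL4 (\<tau> g)" if "g \<in> carrier G" for g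
      using P(2)[OF fix_\<phi> fix_v] that by (simp add: \<tau>_def)
    have \<tau>hom: "\<tau> \<in> hom G SL"
    proof (rule homI)
      fix g assume g: "g \<in> carrier G"
      have "det (\<sigma> g) = 1" using hom_in_carrier[OF \<sigma>hom g] by (simp add: SL_def)
      then show "\<tau> g \<in> carrier SL"
        using arg_cong[OF \<tau>[OF g], of det] P(1) by (simp add: det_mul SL_def det_SL3_to_SL4)
      fix g' assume g': "g' \<in> carrier G"
      have gg': "g \<otimes>\<^bsub>G\<^esub> g' \<in> carrier G"
        using g g' group_presented_group unfolding G_def by (meson group.is_monoid monoid.m_closed)
      have "P ** SL3_to_SL4 (\<tau> (g \<otimes>\<^bsub>G\<^esub> g')) = \<sigma> g ** (\<sigma> g' ** P)"
        using hom_mult[OF \<sigma>hom g g'] by (simp add: SL_def matrix_mul_assoc flip: \<tau>[OF gg'])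
      also have "\<dots> = P ** SL3_to_SL4 (\<tau> g ** \<tau> g')"
        by (simp add: \<tau>[OF g'] SL3_to_SL4_mult matrix_mul_assoc \<tau>[OF g])
      finally have "matrix_inv P ** P ** SL3_to_SL4 (\<tau> (g \<otimes>\<^bsub>G\<^esub> g')) = matrix_inv P ** P ** SL3_to_SL4 (\<tau> g ** \<tau> g')"
        by (simp flip: matrix_mul_assoc)
      then show "\<tau> (g \<otimes>\<^bsub>G\<^esub> g') = \<tau> g \<otimes>\<^bsub>SL\<^esub> \<tau> g'"
        by (simp add: PP SL3_to_SL4_inject SL_def)
    qed
    have "\<tau> g \<in> X g" if g: "g \<in> carrier G" for g
    proof (cases "g \<in> J")
      case True
      then have "dist (\<tau> g) (\<rho> g) \<le> 18 * \<delta>"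
        using dist_block_part_le[OF near \<phi>_le, of g] g by (simp add: \<tau>_def K_def)
      also have "\<dots> < \<epsilon>" using \<delta>_le(4) \<epsilon> by simp
      also have "\<dots> \<le> e g" by (rule \<epsilon>_le[OF True])
      finally show ?thesis using e[OF g] by (auto simp: dist_commute)
    qed (use g in \<open>simp add: J_def\<close>)
    then have "\<tau> \<in> PiE (carrier G) X" by (auto simp: \<tau>_def)
    then have "\<tau> \<in> W" using X(4) \<tau>hom W'(2) by blast
    moreover have "conjugate_reps G \<sigma> (extend_rep G \<tau>)"
      unfolding conjugate_reps_def
    proof (intro exI[of _ P] conjI ballI P(1))
      fix g assume g: "g \<in> carrier G"
      have "\<sigma> g = \<sigma> g ** P ** matrix_inv P" by (simp add: PP flip: matrix_mul_assoc)
      then show "\<sigma> g = P ** extend_rep G \<tau> g ** matrix_inv P"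
        using g by (simp add: \<tau>[OF g] extend_rep_def)
    qed
    ultimately show ?thesis by blast
  qed
  then show ?thesis using V_open \<rho>V unfolding G_def by blast
qed

section \<open>Holonomies of convex projective structures\<close>

lemma span_scaleR_singleton:
  fixes x :: "'a::real_vector"
  assumes "c \<noteq> 0"
  shows "span {c *\<^sub>R x} = span {x}"
proof -
  have "(1 / c) *\<^sub>R (c *\<^sub>R x) \<in> span {c *\<^sub>R x}" by (intro span_scale span_base) simp
  then have "x \<in> span {c *\<^sub>R x}" using assms by simp
  moreover have "c *\<^sub>R x \<in> span {x}" by (intro span_scale span_base) simp
  ultimately show ?thesis unfolding span_eq by blast
qed

lemma proj_act_span: "proj_act A (span {x}) = span {A *v x}"
  unfolding proj_act_def using linear_span_image[OF matrix_vector_mul_linear, of A "{x}"] by simp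

text \<open>Homogeneous version of the chart where \<open>w\<close> is 1, on which matrices act
  linearly; positivity of \<open>w\<close> selects one of the two opposite cones.\<close>

definition chart_cone :: "(real^3) set set \<Rightarrow> real^3 \<Rightarrow> (real^3) set" where
  "chart_cone \<Omega> w = {x. w \<bullet> x > 0 \<and> span {x} \<in> \<Omega>}"

context
  fixes \<Omega> :: "(real^3) set set" and w :: "real^3"
  assumes \<Omega>: "openin projective_space \<Omega>" and nonempty: "\<Omega> \<noteq> {}"
    and chart: "\<And>l. l \<in> \<Omega> \<Longrightarrow> \<not> l \<subseteq> {x. w \<bullet> x = 0}"
    and convex: "convex {x. w \<bullet> x = 1 \<and> span {x} \<in> \<Omega>}"
begin

lemma open_chart_cone: "open (chart_cone \<Omega> w)"
proof -
  have "chart_cone \<Omega> w = {v. v \<noteq> 0 \<and> span {v} \<in> \<Omega>} \<inter> {x. w \<bullet> x > 0}"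
    by (auto simp: chart_cone_def)
  then show ?thesis using \<Omega> open_halfspace_gt by (auto simp: openin_projective_space)
qed

lemma scale_chart_cone: "\<lbrakk>x \<in> chart_cone \<Omega> w; c > 0\<rbrakk> \<Longrightarrow> c *\<^sub>R x \<in> chart_cone \<Omega> w"
  by (simp add: chart_cone_def span_scaleR_singleton)

text \<open>The points are scaled into the chart where \<open>w\<close> is 1. The weights
  \<open>u * s / r\<close> and \<open>v * t / r\<close> make the convex combination there
  proportional to the given one.\<close>

lemma convex_chart_cone: "convex (chart_cone \<Omega> w)"
proof (rule convexI)
  fix x y :: "real^3" and u v :: real
  assume x: "x \<in> chart_cone \<Omega> w" and y: "y \<in> chart_cone \<Omega> w" and uv: "u \<ge> 0" "v \<ge> 0" "u + v = 1"
  define s t where "s = w \<bullet> x" and "t = w \<bullet> y"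
  have st: "s > 0" "t > 0" using x y by (auto simp: chart_cone_def s_def t_def)
  define r where "r = u * s + v * t"
  have r: "r > 0"
  proof (cases "u = 0")
    case False
    then have "u * s > 0" using uv st by simp
    then show ?thesis using uv st by (simp add: r_def add_pos_nonneg)
  qed (use uv st in \<open>simp add: r_def\<close>)
  have "(1 / s) *\<^sub>R x \<in> {x. w \<bullet> x = 1 \<and> span {x} \<in> \<Omega>}" "(1 / t) *\<^sub>R y \<in> {x. w \<bullet> x = 1 \<and> span {x} \<in> \<Omega>}"
    using x y st by (auto simp: chart_cone_def span_scaleR_singleton s_def t_def)
  then have "(u * s / r) *\<^sub>R ((1 / s) *\<^sub>R x) + (v * t / r) *\<^sub>R ((1 / t) *\<^sub>R y) \<in> {x. w \<bullet> x = 1 \<and> span {x} \<in> \<Omega>}"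
    using r st uv by (intro convexD[OF convex]) (auto simp: r_def simp flip: add_divide_distrib)
  moreover define p where "p = (1 / r) *\<^sub>R (u *\<^sub>R x + v *\<^sub>R y)"
  have "(u * s / r) *\<^sub>R ((1 / s) *\<^sub>R x) + (v * t / r) *\<^sub>R ((1 / t) *\<^sub>R y) = p"
    using st by (simp add: p_def scaleR_add_right)
  ultimately have "p \<in> chart_cone \<Omega> w" by (simp add: chart_cone_def)
  from scale_chart_cone[OF this r] show "u *\<^sub>R x + v *\<^sub>R y \<in> chart_cone \<Omega> w"
    using r by (simp add: p_def)
qed

lemma chart_cone_cases:
  assumes "span {x} \<in> \<Omega>"
  shows "x \<in> chart_cone \<Omega> w \<or> - x \<in> chart_cone \<Omega> w"
proof -
  have "w \<bullet> x \<noteq> 0"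
  proof
    assume "w \<bullet> x = 0"
    then have "span {x} \<subseteq> {x. w \<bullet> x = 0}" by (auto simp: span_singleton)
    then show False using chart[OF assms] by blast
  qed
  moreover have "span {- x} = span {x}" using span_scaleR_singleton[of "-1" x] by simp
  ultimately show ?thesis using assms by (auto simp: chart_cone_def)
qed

lemma chart_cone_nonempty: "chart_cone \<Omega> w \<noteq> {}"
proof -
  obtain l where l: "l \<in> \<Omega>" using nonempty by auto
  then obtain x where "l = span {x}" using \<Omega> by (auto simp: openin_projective_space)
  then show ?thesis using chart_cone_cases l by blast
qed

end

lemma convex_projective_holonomy_no_common_fixed:
  assumes T: "turnover T" "orbifold_euler_char T < 0" and hol: "convex_projective_holonomy T \<gamma> \<rho>"
  shows "\<lbrakk>\<rho> (pi1_gen T C1) *v v = v; \<rho> (pi1_gen T C2) *v v = v\<rbrakk> \<Longrightarrow> v = 0"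
    and "\<lbrakk>\<phi> v* \<rho> (pi1_gen T C1) = \<phi>; \<phi> v* \<rho> (pi1_gen T C2) = \<phi>\<rbrakk> \<Longrightarrow> \<phi> = 0"
proof -
  obtain \<Omega> \<Gamma> q where struct: "convex_projective_structure T \<Omega> \<Gamma> q"
    and iso: "\<rho> \<in> iso (orbifold_pi1 T) (SL\<lparr>carrier := \<Gamma>\<rparr>)"
    using hol unfolding convex_projective_holonomy_def by blast
  have dom: "convex_domain \<Omega>" and sub: "subgroup \<Gamma> SL"
    and act: "\<And>A. A \<in> \<Gamma> \<Longrightarrow> proj_act A ` \<Omega> = \<Omega>"
    and proper: "\<And>K. \<lbrakk>K \<subseteq> \<Omega>; compactin projective_space K\<rbrakk> \<Longrightarrow> finite {A\<in>\<Gamma>. proj_act A ` K \<inter> K \<noteq> {}}"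
    using struct unfolding convex_projective_structure_def by blast+
  obtain w where w: "openin projective_space \<Omega>" "\<Omega> \<noteq> {}"
    "\<And>l. l \<in> \<Omega> \<Longrightarrow> \<not> l \<subseteq> {x. w \<bullet> x = 0}" "convex {x. w \<bullet> x = 1 \<and> span {x} \<in> \<Omega>}"
    using dom unfolding convex_domain_def by blast
  let ?R = "turnover_relators T"
  let ?D = "chart_cone \<Omega> w"
  let ?r = "\<lambda>u. \<rho> (word_class ?R u)"
  have \<Gamma>_SL: "\<Gamma> \<subseteq> carrier SL" using sub by (rule subgroup.subset)
  have hom': "\<rho> \<in> hom (orbifold_pi1 T) (SL\<lparr>carrier := \<Gamma>\<rparr>)" and bij: "bij_betw \<rho> (carrier (orbifold_pi1 T)) \<Gamma>"
    using iso by (auto simp: iso_def)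
  have hom: "\<rho> \<in> hom (orbifold_pi1 T) SL"
    using hom' \<Gamma>_SL unfolding hom_def by auto
  note word = hom_SL_word[OF hom]
  have mem: "word_class ?R u \<in> carrier (orbifold_pi1 T)" for u by (simp add: presented_group_def)
  have r\<Gamma>: "?r u \<in> \<Gamma>" for u using bij mem by (auto simp: bij_betw_def)
  \<comment> \<open>Faithfulness: an identity between matrices of the holonomy is an identity
    between words, which the computation in SL_2(C) can refute.\<close>
  have r_inj: "word_eq ?R u v" if "?r u = ?r v" for u v
    using bij_betw_imp_inj_on[OF bij] mem that by (metis inj_onD word_class_eq_iff)
  interpret convex_cone_action ?D \<Gamma>
  proof
    show "open ?D" by (rule open_chart_cone[OF w])
    show "convex ?D" by (rule convex_chart_cone[OF w])
    show "?D \<noteq> {}" by (rule chart_cone_nonempty[OF w])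
    show "c *\<^sub>R x \<in> ?D" if "x \<in> ?D" "c > 0" for x c using scale_chart_cone[OF w that] .
    show "- x \<notin> ?D" if "x \<in> ?D" for x using that by (simp add: chart_cone_def)
    show "det A = 1" if "A \<in> \<Gamma>" for A using \<Gamma>_SL that by (auto simp: SL_def)
    show "\<exists>B\<in>\<Gamma>. A ** B = mat 1" if A: "A \<in> \<Gamma>" for A
    proof -
      obtain g where g: "g \<in> carrier (orbifold_pi1 T)" "A = \<rho> g"
        using A bij by (auto simp: bij_betw_def)
      interpret G: group "orbifold_pi1 T" by (rule group_presented_group)
      have "\<rho> g ** \<rho> (inv\<^bsub>orbifold_pi1 T\<^esub> g) = \<rho> \<one>\<^bsub>orbifold_pi1 T\<^esub>"
        using hom_mult[OF hom g(1) G.inv_closed[OF g(1)]] g(1) by (simp add: SL_def)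
      also have "\<dots> = mat 1" using word(3) by (simp add: presented_group_def)
      finally show ?thesis using g bij G.inv_closed[OF g(1)] by (auto simp: bij_betw_def)
    qed
    show "A *v x \<in> ?D \<or> - (A *v x) \<in> ?D" if "A \<in> \<Gamma>" "x \<in> ?D" for A x
    proof -
      have "proj_act A (span {x}) \<in> \<Omega>" using act[OF that(1)] that(2) by (auto simp: chart_cone_def)
      then show ?thesis using chart_cone_cases[OF w] by (simp add: proj_act_span)
    qed
  qed
  define a b h where "a = \<rho> (pi1_gen T C1)" and "b = \<rho> (pi1_gen T C2)" and "h = ?r commutator_word"
  have ab: "a = ?r [(C1, True)]" "b = ?r [(C2, True)]" by (simp_all add: a_def b_def pi1_gen_def)
  have in\<Gamma>: "a \<in> \<Gamma>" "b \<in> \<Gamma>" "h \<in> \<Gamma>" using r\<Gamma> by (simp_all add: ab h_def)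
  have ord: "cone_order T i > 0" for i
  proof -
    have "cone_order T i \<ge> 2" using T by (simp add: turnover_def)
    then show ?thesis by simp
  qed
  have fin: "mpow a (cone_order T C1) = mat 1" "mpow b (cone_order T C2) = mat 1"
    unfolding a_def b_def by (rule pi1_gen_order[OF hom])+
  have hba: "h ** b ** a = a ** b"
  proof -
    have "h = a ** b ** ?r [(C1, False)] ** ?r [(C2, False)]"
      using word(2)[of "[(C1, True)]" "[(C2, True), (C1, False), (C2, False)]"]
        word(2)[of "[(C2, True)]" "[(C1, False), (C2, False)]"] word(2)[of "[(C1, False)]" "[(C2, False)]"]
      by (simp add: h_def commutator_word_def ab matrix_mul_assoc)
    then have "h ** b ** a = a ** b ** (?r [(C1, False)] ** (?r [(C2, False)] ** b) ** a)"
      by (simp add: matrix_mul_assoc)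
    also have "\<dots> = a ** b" using word(7)[of C1 False] word(7)[of C2 False] by (simp add: ab)
    finally show ?thesis .
  qed
  \<comment> \<open>A single point of the domain is compact, so by properness its stabiliser is
    finite. Two powers of \<open>h\<close> would then coincide, against infinite order.\<close>
  have no_fixed: "h *v x \<noteq> x" if x: "x \<in> ?D" for x
  proof
    assume hx: "h *v x = x"
    have x\<Omega>: "span {x} \<in> \<Omega>" using x by (simp add: chart_cone_def)
    then have "compactin projective_space {span {x}}"
      using openin_subset[OF w(1)] by auto
    then have "finite {A\<in>\<Gamma>. proj_act A ` {span {x}} \<inter> {span {x}} \<noteq> {}}"
      by (rule proper[rotated]) (use x\<Omega> in simp)
    moreover have "mpow h k *v x = x" for k
      by (induction k) (simp_all add: hx flip: matrix_vector_mul_assoc)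
    moreover have mpow_r: "mpow h k = ?r (concat (replicate k commutator_word))" for k
      by (simp add: h_def word(4))
    then have "mpow h k \<in> \<Gamma>" for k using r\<Gamma> by metis
    ultimately have "finite (range (mpow h))"
      by (elim finite_subset[rotated]) (simp add: image_subset_iff proj_act_span)
    then have "\<not> inj (mpow h)" using finite_imageD[of "mpow h" UNIV] by auto
    then obtain i j where "i \<noteq> j" "mpow h i = mpow h j" unfolding inj_def by blast
    then obtain i j where ij: "i < j" "mpow h i = mpow h j"
      by (cases "i < j") (auto simp: not_less_iff_gr_or_eq)
    have "det (mpow h i) = 1" unfolding mpow_r by (rule word(1))
    then obtain Y where Y: "Y ** mpow h i = mat 1"
      by (metis invertible_det_nz invertible_def zero_neq_one)
    have "mpow h i ** mpow h (j - i) = mpow h i"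
      using ij mpow_add[of h i "j - i"] by simp
    then have "Y ** mpow h i ** mpow h (j - i) = Y ** mpow h i" by (simp flip: matrix_mul_assoc)
    then have "mpow h (j - i) = mat 1" by (simp add: Y)
    then have "?r (concat (replicate (j - i) commutator_word)) = ?r []" by (simp only: mpow_r word(3))
    from r_inj[OF this] show False using commutator_word_props(1)[OF T, of "j - i"] ij(1) by simp
  qed
  have nc: "\<exists>s\<in>{a, b}. \<exists>s'. s ** s' = mat 1 \<and> h ** (s ** h ** s') \<noteq> (s ** h ** s') ** h"
  proof -
    obtain s where s: "s \<in> {C1, C2}" and neq: "\<not> word_eq ?R
      (commutator_word @ [(s, True)] @ commutator_word @ [(s, False)])
      ([(s, True)] @ commutator_word @ [(s, False)] @ commutator_word)"
      using commutator_word_props(2)[OF T] by blast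
    have "?r (commutator_word @ [(s, True)] @ commutator_word @ [(s, False)]) \<noteq>
      ?r ([(s, True)] @ commutator_word @ [(s, False)] @ commutator_word)"
      using neq r_inj by blast
    then have "h ** (?r [(s, True)] ** h ** ?r [(s, False)]) \<noteq> (?r [(s, True)] ** h ** ?r [(s, False)]) ** h"
      unfolding word(2) h_def by (simp add: matrix_mul_assoc)
    moreover have "?r [(s, True)] \<in> {a, b}" using s by (auto simp: ab)
    moreover have "?r [(s, True)] ** ?r [(s, False)] = mat 1" using word(7)[of s True] by simp
    ultimately show ?thesis by blast
  qed
  note hyps = in\<Gamma>(1) ord fin(1) in\<Gamma>(2) ord fin(2) in\<Gamma>(3) hba no_fixed nc
  show "v = 0" if "\<rho> (pi1_gen T C1) *v v = v" "\<rho> (pi1_gen T C2) *v v = v"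
    using no_common_fixed_vector[OF hyps] that by (simp add: a_def b_def)
  show "\<phi> = 0" if "\<phi> v* \<rho> (pi1_gen T C1) = \<phi>" "\<phi> v* \<rho> (pi1_gen T C2) = \<phi>"
    using no_common_fixed_covector[OF hyps] that by (simp add: a_def b_def)
qed

theorem corollary4p4:
  fixes T :: turnover
    and \<gamma> :: "cone \<Rightarrow> real \<Rightarrow> real^3"
    and \<rho> :: "cone word set \<Rightarrow> real^3^3"
  assumes "turnover T"
    and "orbifold_euler_char T < 0"
    and "standard_loops T \<gamma>"
    and "\<rho> \<in> topspace (rep_space (orbifold_pi1 T))"
    and "convex_projective_holonomy T \<gamma> \<rho>"
  shows "\<forall>W. openin (rep_space (orbifold_pi1 T)) W \<and> \<rho> \<in> W \<longrightarrow>
           (\<exists>V. openin (rep_space (orbifold_pi1 T)) V \<and> extend_rep (orbifold_pi1 T) \<rho> \<in> V \<and>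
             (\<forall>\<sigma>\<in>V. \<exists>\<tau>\<in>W. conjugate_reps (orbifold_pi1 T) \<sigma> (extend_rep (orbifold_pi1 T) \<tau>)))"
proof (intro allI impI)
  fix W assume "openin (rep_space (orbifold_pi1 T)) W \<and> \<rho> \<in> W"
  then show "\<exists>V. openin (rep_space (orbifold_pi1 T)) V \<and> extend_rep (orbifold_pi1 T) \<rho> \<in> V \<and>
      (\<forall>\<sigma>\<in>V. \<exists>\<tau>\<in>W. conjugate_reps (orbifold_pi1 T) \<sigma> (extend_rep (orbifold_pi1 T) \<tau>))"
    using deformation_conjugate_to_SL3[OF assms(1,4)]
      convex_projective_holonomy_no_common_fixed[OF assms(1,2,5)] by blast
qed

end
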